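(* Let $D$, $n_1$, $\eta$ be as in the context. If $n_1-1$ is uniformly positive (or uniformly negative) in $D$, i.e. there is $c>0$ with $n_1-1\ge c$ a.e. or $n_1-1\le -c$ a.e. in $D$, then for every $k\in\mathbb{C}$ with $\mathrm{Re}(k)>0$ the operator $\mathbb{B}_{n_2,k}$ converges in operator norm to $\mathbb{B}_{0,k}$ as $n_2\to0$ in $L^\infty(D)$.
   Context: Let $d\in\{2,3\}$ and let $D\subset\mathbb{R}^d$ be a bounded simply connected open set with $\mathcal{C}^2$ boundary and unit outward normal $\nu$. $n_1\in L^\infty(D)$ is real-valued and positive; $n_2\in L^\infty(D)$ is real-valued and nonnegative (absorption); $\eta\in L^\infty(\partial D)$ is a fixed real-valued positive conductivity with $1/\eta\in L^\infty(\partial D)$. $X=H^2(D)\cap H^1_0(D)=\{u\in H^2(D):u=0\text{ on }\partial D\}$ with the $H^2(D)$ inner product. For $\mathrm{Re}(k)>0$, the bounded linear operator $\mathbb{B}_{n_2,k}:X\to X$ is defined via the Riesz representation theorem by $$(\mathbb{B}_{n_2,k}u,\varphi)_{H^2(D)}=\int_{\partial D}\frac1\eta\frac{\partial u}{\partial\nu}\frac{\partial\overline\varphi}{\partial\nu}\,ds-\int_D\nabla u\cdot\nabla\overline\varphi\,dx+k^2\int_D\frac{kn_1+\mathrm{i}n_2}{k(n_1-1)+\mathrm{i}n_2}u\overline\varphi\,dx+k\int_D\frac{1}{k(n_1-1)+\mathrm{i}n_2}(\overline\varphi\,\Delta u+u\,\Delta\overline\varphi)\,dx$$ for all $\varphi\in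 X$; $\mathbb{B}_{0,k}$ is the operator with $n_2=0$. *)

theory Defs
  imports "HOL-Analysis.Analysis" "HOL-Probability.Essential_Supremum"
begin

text \<open>Intended for open \<open>S\<close>: all directional derivatives up to order \<open>k\<close> exist and are continuous.\<close>

primrec Ck_on :: "nat \<Rightarrow> 'a::euclidean_space set \<Rightarrow> ('a \<Rightarrow> 'b::real_normed_vector) \<Rightarrow> bool" where
  "Ck_on 0 S f \<longleftrightarrow> continuous_on S f"
| "Ck_on (Suc k) S f \<longleftrightarrow>
     (\<forall>x\<in>S. f differentiable (at x)) \<and> (\<forall>v. Ck_on k S (\<lambda>x. frechet_derivative f (at x) v))"

definition smooth :: "('a::euclidean_space \<Rightarrow> 'b::real_normed_vector) \<Rightarrow> bool" where
  "smooth f \<longleftrightarrow> (\<forall>k. Ck_on k UNIV f)"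

definition test_functions :: "'a::euclidean_space set \<Rightarrow> ('a \<Rightarrow> complex) set" where
  "test_functions D =
     {\<phi>. smooth \<phi> \<and> compact (closure {x. \<phi> x \<noteq> 0}) \<and> closure {x. \<phi> x \<noteq> 0} \<subseteq> D}"

text \<open>In coordinates \<open>y = y' + t e\<close> with \<open>y'\<close> orthogonal to the unit vector \<open>e\<close>, the set where
  \<open>graph_level e \<gamma> < 0\<close> is the part \<open>t > \<gamma> y'\<close> above the graph of \<open>\<gamma>\<close>. Only the values of \<open>\<gamma>\<close> on
  the hyperplane orthogonal to \<open>e\<close> matter.\<close>

definition graph_level :: "'a::euclidean_space \<Rightarrow> ('a \<Rightarrow> real) \<Rightarrow> 'a \<Rightarrow> real" where
  "graph_level e \<gamma> y = \<gamma> (y - (y \<bullet> e) *\<^sub>R e) - y \<bullet> e"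

definition local_C2_graph ::
  "'a::euclidean_space set \<Rightarrow> 'a \<Rightarrow> 'a \<Rightarrow> ('a \<Rightarrow> real) \<Rightarrow> bool" where
  "local_C2_graph D x e \<gamma> \<longleftrightarrow>
     norm e = 1 \<and> Ck_on 2 UNIV \<gamma> \<and>
     (\<exists>r>0. D \<inter> ball x r = {y \<in> ball x r. graph_level e \<gamma> y < 0})"

definition C2_boundary :: "'a::euclidean_space set \<Rightarrow> bool" where
  "C2_boundary D \<longleftrightarrow> (\<forall>x\<in>frontier D. \<exists>e \<gamma>. local_C2_graph D x e \<gamma>)"

text \<open>The gradient of the level function, which is negative inside \<open>D\<close>, points outwards.\<close>

definition outward_normal :: "'a::euclidean_space set \<Rightarrow> 'a \<Rightarrow> 'a" where
  "outward_normal D x =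
     (THE \<nu>. norm \<nu> = 1 \<and>
        (\<exists>e \<gamma> c. local_C2_graph D x e \<gamma> \<and> c > 0 \<and>
           (graph_level e \<gamma> has_derivative (\<lambda>h. c * (\<nu> \<bullet> h))) (at x)))"

text \<open>Hausdorff measure of dimension \<open>s > 0\<close>, normalised to agree with Lebesgue measure for integer
  \<open>s\<close>. Boundedness is required because \<^const>\<open>diameter\<close> is meaningless on unbounded sets.\<close>

definition hausdorff_pre :: "real \<Rightarrow> real \<Rightarrow> 'a::euclidean_space set \<Rightarrow> ennreal" where
  "hausdorff_pre s \<delta> A =
     (INF U \<in> {U :: nat \<Rightarrow> 'a set. A \<subseteq> (\<Union>i. U i) \<and> (\<forall>i. bounded (U i) \<and> diameter (U i) \<le> \<delta>)}.
        \<Sum>i. ennreal (unit_ball_vol s * (diameter (U i) / 2) powr s))"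

definition hausdorff_outer :: "real \<Rightarrow> 'a::euclidean_space set \<Rightarrow> ennreal" where
  "hausdorff_outer s A = (SUP \<delta>\<in>{0<..}. hausdorff_pre s \<delta> A)"

definition hausdorff_measure :: "real \<Rightarrow> 'a::euclidean_space measure" where
  "hausdorff_measure s =
     measure_of UNIV (lambda_system UNIV UNIV (hausdorff_outer s)) (hausdorff_outer s)"

definition surface_measure :: "'a::euclidean_space set \<Rightarrow> 'a measure" where
  "surface_measure D = restrict_space (hausdorff_measure (real (DIM('a) - 1))) (frontier D)"

text \<open>Elements of Lebesgue and Sobolev spaces are represented by functions, whose values off \<open>D\<close> (or
  \<open>frontier D\<close>) and on null sets are irrelevant. Accordingly, objects that are unique only up to
  almost everywhere equality are selected by \<open>SOME\<close>.\<close>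

definition L2 :: "'a measure \<Rightarrow> ('a \<Rightarrow> complex) set" where
  "L2 M = {f \<in> borel_measurable M. integrable M (\<lambda>x. (norm (f x))\<^sup>2)}"

definition Linf :: "'a measure \<Rightarrow> ('a \<Rightarrow> real) set" where
  "Linf M = {f \<in> borel_measurable M. \<exists>C. AE x in M. \<bar>f x\<bar> \<le> C}"

definition Linf_norm :: "'a measure \<Rightarrow> ('a \<Rightarrow> real) \<Rightarrow> ennreal" where
  "Linf_norm M f = esssup M (\<lambda>x. ennreal \<bar>f x\<bar>)"

definition L2_inner :: "'a measure \<Rightarrow> ('a \<Rightarrow> complex) \<Rightarrow> ('a \<Rightarrow> complex) \<Rightarrow> complex" where
  "L2_inner M f g = (LINT x|M. f x * cnj (g x))"

definition is_weak_partial ::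
  "'a::euclidean_space set \<Rightarrow> 'a \<Rightarrow> ('a \<Rightarrow> complex) \<Rightarrow> ('a \<Rightarrow> complex) \<Rightarrow> bool" where
  "is_weak_partial D i u g \<longleftrightarrow>
     (\<forall>\<phi>\<in>test_functions D.
        (LINT x|lebesgue_on D. u x * frechet_derivative \<phi> (at x) i) =
        - (LINT x|lebesgue_on D. g x * \<phi> x))"

definition weak_partial ::
  "'a::euclidean_space set \<Rightarrow> 'a \<Rightarrow> ('a \<Rightarrow> complex) \<Rightarrow> 'a \<Rightarrow> complex" where
  "weak_partial D i u = (SOME g. g \<in> L2 (lebesgue_on D) \<and> is_weak_partial D i u g)"

definition weak_laplacian ::
  "'a::euclidean_space set \<Rightarrow> ('a \<Rightarrow> complex) \<Rightarrow> 'a \<Rightarrow> complex" where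
  "weak_laplacian D u x = (\<Sum>i\<in>Basis. weak_partial D i (weak_partial D i u) x)"

definition H1 :: "'a::euclidean_space set \<Rightarrow> ('a \<Rightarrow> complex) set" where
  "H1 D = {u \<in> L2 (lebesgue_on D).
             \<forall>i\<in>Basis. \<exists>g\<in>L2 (lebesgue_on D). is_weak_partial D i u g}"

definition H1_inner ::
  "'a::euclidean_space set \<Rightarrow> ('a \<Rightarrow> complex) \<Rightarrow> ('a \<Rightarrow> complex) \<Rightarrow> complex" where
  "H1_inner D u v =
     L2_inner (lebesgue_on D) u v +
     (\<Sum>i\<in>Basis. L2_inner (lebesgue_on D) (weak_partial D i u) (weak_partial D i v))"

definition H1_norm :: "'a::euclidean_space set \<Rightarrow> ('a \<Rightarrow> complex) \<Rightarrow> real" where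
  "H1_norm D u = sqrt (Re (H1_inner D u u))"

definition H10 :: "'a::euclidean_space set \<Rightarrow> ('a \<Rightarrow> complex) set" where
  "H10 D = {u \<in> H1 D. \<forall>\<epsilon>>0. \<exists>\<phi>\<in>test_functions D. H1_norm D (\<lambda>x. u x - \<phi> x) < \<epsilon>}"

definition H2 :: "'a::euclidean_space set \<Rightarrow> ('a \<Rightarrow> complex) set" where
  "H2 D = {u \<in> H1 D. \<forall>i\<in>Basis. weak_partial D i u \<in> H1 D}"

definition H2_inner ::
  "'a::euclidean_space set \<Rightarrow> ('a \<Rightarrow> complex) \<Rightarrow> ('a \<Rightarrow> complex) \<Rightarrow> complex" where
  "H2_inner D u v =
     H1_inner D u v +
     (\<Sum>i\<in>Basis. \<Sum>j\<in>Basis.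
        L2_inner (lebesgue_on D)
          (weak_partial D i (weak_partial D j u)) (weak_partial D i (weak_partial D j v)))"

definition H2_norm :: "'a::euclidean_space set \<Rightarrow> ('a \<Rightarrow> complex) \<Rightarrow> real" where
  "H2_norm D u = sqrt (Re (H2_inner D u u))"

definition X_space :: "'a::euclidean_space set \<Rightarrow> ('a \<Rightarrow> complex) set" where
  "X_space D = H2 D \<inter> H10 D"

text \<open>The trace is the continuous extension to \<open>H1 D\<close> of restriction to \<open>frontier D\<close>, from the
  dense subspace of functions smooth up to the boundary.\<close>

definition is_trace ::
  "'a::euclidean_space set \<Rightarrow> ('a \<Rightarrow> complex) \<Rightarrow> ('a \<Rightarrow> complex) \<Rightarrow> bool" where
  "is_trace D v g \<longleftrightarrow>
     g \<in> L2 (surface_measure D) \<and>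
     (\<exists>\<psi> :: nat \<Rightarrow> 'a \<Rightarrow> complex.
        (\<forall>j. smooth (\<psi> j)) \<and>
        (\<lambda>j. H1_norm D (\<lambda>x. \<psi> j x - v x)) \<longlonglongrightarrow> 0 \<and>
        (\<lambda>j. LINT x|surface_measure D. (norm (\<psi> j x - g x))\<^sup>2) \<longlonglongrightarrow> 0)"

definition sobolev_trace :: "'a::euclidean_space set \<Rightarrow> ('a \<Rightarrow> complex) \<Rightarrow> 'a \<Rightarrow> complex" where
  "sobolev_trace D v = (SOME g. is_trace D v g)"

definition normal_deriv ::
  "'a::euclidean_space set \<Rightarrow> ('a \<Rightarrow> complex) \<Rightarrow> 'a \<Rightarrow> complex" where
  "normal_deriv D u x =
     (\<Sum>i\<in>Basis. complex_of_real (outward_normal D x \<bullet> i) * sobolev_trace D (weak_partial D i u) x)"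

definition B_form ::
  "'a::euclidean_space set \<Rightarrow> ('a \<Rightarrow> real) \<Rightarrow> ('a \<Rightarrow> real) \<Rightarrow> ('a \<Rightarrow> real) \<Rightarrow> complex \<Rightarrow>
   ('a \<Rightarrow> complex) \<Rightarrow> ('a \<Rightarrow> complex) \<Rightarrow> complex" where
  "B_form D \<eta> n1 n2 k u \<phi> =
     (LINT x|surface_measure D.
        complex_of_real (1 / \<eta> x) * normal_deriv D u x * cnj (normal_deriv D \<phi> x))
     - (LINT x|lebesgue_on D. (\<Sum>i\<in>Basis. weak_partial D i u x * cnj (weak_partial D i \<phi> x)))
     + k\<^sup>2 * (LINT x|lebesgue_on D.
        (k * complex_of_real (n1 x) + \<i> * complex_of_real (n2 x))
          / (k * complex_of_real (n1 x - 1) + \<i> * complex_of_real (n2 x))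
          * u x * cnj (\<phi> x))
     + k * (LINT x|lebesgue_on D.
        1 / (k * complex_of_real (n1 x - 1) + \<i> * complex_of_real (n2 x))
          * (cnj (\<phi> x) * weak_laplacian D u x + u x * cnj (weak_laplacian D \<phi> x)))"

definition B_op ::
  "'a::euclidean_space set \<Rightarrow> ('a \<Rightarrow> real) \<Rightarrow> ('a \<Rightarrow> real) \<Rightarrow> ('a \<Rightarrow> real) \<Rightarrow> complex \<Rightarrow>
   ('a \<Rightarrow> complex) \<Rightarrow> 'a \<Rightarrow> complex" where
  "B_op D \<eta> n1 n2 k u =
     (SOME w. w \<in> X_space D \<and> (\<forall>\<phi>\<in>X_space D. H2_inner D w \<phi> = B_form D \<eta> n1 n2 k u \<phi>))"

definition op_norm ::
  "'a::euclidean_space set \<Rightarrow> (('a \<Rightarrow> complex) \<Rightarrow> 'a \<Rightarrow> complex) \<Rightarrow> ennreal" where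
  "op_norm D T = (SUP u\<in>{u \<in> X_space D. H2_norm D u \<le> 1}. ennreal (H2_norm D (T u)))"

definition absorption_to_zero :: "'a::euclidean_space set \<Rightarrow> ('a \<Rightarrow> real) filter" where
  "absorption_to_zero D =
     inf (filtercomap (Linf_norm (lebesgue_on D)) (nhds 0))
         (principal {n2 \<in> Linf (lebesgue_on D). AE x in lebesgue_on D. 0 \<le> n2 x})"

end

theory Submission
  imports Defs "HOL-Library.Sublist"
begin

text \<open>The boundary and gradient terms of the form do not depend on the absorption, so the difference of
  the forms for \<open>n2\<close> and for \<open>0\<close> only involves the coefficient
  \<open>1 / (k (n1 - 1) + \<i> n2) - 1 / (k (n1 - 1))\<close>, which is bounded by a multiple of the supremum norm of
  \<open>n2\<close> because \<open>n1 - 1\<close> is bounded away from zero. By the Cauchy--Schwarz inequality this difference is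
  a bounded antilinear functional on \<open>X\<close> whose norm is controlled by that of \<open>n2\<close>. The Riesz theorem on
  the complete space \<open>X\<close> represents it, so the problems for \<open>n2\<close> and for \<open>0\<close> are solvable for the same
  \<open>u\<close>, and no trace theorem is needed. Linearity of all the maps involved rests on the almost everywhere
  uniqueness of weak derivatives, that is, on the fundamental lemma of the calculus of variations.\<close>

section \<open>Riesz representation in semi-inner product spaces\<close>

text \<open>Elements of \<open>X_space\<close> are functions rather than classes, and weak
  derivatives are picked by \<open>SOME\<close>. So \<open>H2_norm\<close> is only a seminorm and
  differentiation is linear only almost everywhere, which is why the Hilbert space argument is run
  for semi-inner products on sets of functions. \<open>B_op\<close> is a \<open>SOME\<close> too,
  and its defining predicate may a priori be empty; the two operators are therefore compared without
  solving either problem.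

  Write d = k (n1 - 1) + i n2. Since k n1 + i n2 = d + k, the zeroth order coefficient is 1 + k / d,
  so the absorption enters the form only through 1 / d, and linearly in 1 / d. Zeros of d are
  excluded by perturbation from n2 = 0: where |n1 - 1| >= c and |n2| <= |k| c / 2, one has |k (n1 -
  1)| >= |k| c and hence |d| >= |k| c / 2. The product of these two lower bounds is the origin of
  the constant 2 / (|k| c)^2 in the final estimate, which is linear in the supremum norm of
  n2.\<close>

locale semi_inner =
  fixes V :: "('a \<Rightarrow> complex) set" and ip :: "('a \<Rightarrow> complex) \<Rightarrow> ('a \<Rightarrow> complex) \<Rightarrow> complex"
  assumes add_mem: "u \<in> V \<Longrightarrow> v \<in> V \<Longrightarrow> (\<lambda>x. u x + v x) \<in> V"
    and scale_mem: "u \<in> V \<Longrightarrow> (\<lambda>x. c * u x) \<in> V"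
    and ip_add: "u \<in> V \<Longrightarrow> v \<in> V \<Longrightarrow> w \<in> V \<Longrightarrow> ip (\<lambda>x. u x + v x) w = ip u w + ip v w"
    and ip_scale: "u \<in> V \<Longrightarrow> w \<in> V \<Longrightarrow> ip (\<lambda>x. c * u x) w = c * ip u w"
    and ip_cnj: "u \<in> V \<Longrightarrow> v \<in> V \<Longrightarrow> ip v u = cnj (ip u v)"
    and ip_nonneg: "u \<in> V \<Longrightarrow> 0 \<le> Re (ip u u)"
begin

definition nrm :: "('a \<Rightarrow> complex) \<Rightarrow> real" where
  "nrm u = sqrt (Re (ip u u))"

lemma nrm_nonneg: "u \<in> V \<Longrightarrow> 0 \<le> nrm u"
  by (simp add: nrm_def ip_nonneg)

lemma nrm_sq: "u \<in> V \<Longrightarrow> (nrm u)\<^sup>2 = Re (ip u u)"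
  by (simp add: nrm_def ip_nonneg)

lemma diff_mem: "u \<in> V \<Longrightarrow> v \<in> V \<Longrightarrow> (\<lambda>x. u x - v x) \<in> V"
  using add_mem[of u "\<lambda>x. -1 * v x"] scale_mem[of v "-1"] by simp

lemma ip_add2:
  assumes "u \<in> V" "v \<in> V" "w \<in> V"
  shows "ip w (\<lambda>x. u x + v x) = ip w u + ip w v"
  using ip_cnj[OF add_mem[OF assms(1,2)] assms(3)] ip_cnj[OF assms(1,3)] ip_cnj[OF assms(2,3)]
  by (simp add: ip_add assms)

lemma ip_scale2:
  assumes "u \<in> V" "w \<in> V"
  shows "ip w (\<lambda>x. c * u x) = cnj c * ip w u"
  using ip_cnj[OF scale_mem[OF assms(1)] assms(2)] ip_cnj[OF assms]
  by (simp add: ip_scale assms)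

lemma ip_diff:
  assumes "u \<in> V" "v \<in> V" "w \<in> V"
  shows "ip (\<lambda>x. u x - v x) w = ip u w - ip v w"
  using ip_add[OF assms(1) scale_mem[OF assms(2), of "-1"] assms(3)] ip_scale[OF assms(2,3), of "-1"]
  by simp

text \<open>The quadratic polynomial along the line through \<open>u\<close> in direction
  \<open>v\<close>. Choosing \<open>c\<close> as a negative multiple of \<open>ip u v\<close> gives
  Cauchy-Schwarz; the same expansion drives the minimisation behind the Riesz theorem.\<close>

lemma nrm_sq_add_scale:
  assumes "u \<in> V" "v \<in> V"
  shows "(nrm (\<lambda>x. u x + c * v x))\<^sup>2 =
    (nrm u)\<^sup>2 + 2 * Re (cnj c * ip u v) + (cmod c)\<^sup>2 * (nrm v)\<^sup>2"
proof -
  have cv: "(\<lambda>x. c * v x) \<in> V" using assms scale_mem by blast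
  have "ip (\<lambda>x. u x + c * v x) (\<lambda>x. u x + c * v x)
      = ip u u + cnj c * ip u v + c * ip v u + c * cnj c * ip v v"
    using assms cv add_mem[OF assms(1) cv]
    by (simp add: ip_add ip_add2 ip_scale ip_scale2 algebra_simps)
  moreover have "Re (c * ip v u) = Re (cnj c * ip u v)"
    using ip_cnj[OF assms] by simp
  moreover have "Re (c * cnj c * ip v v) = (cmod c)\<^sup>2 * Re (ip v v)"
    by (simp only: complex_norm_square[symmetric]) simp
  ultimately show ?thesis
    using assms add_mem[OF assms(1) cv] by (simp only: nrm_sq plus_complex.sel)
qed

lemma nrm_scale:
  assumes "u \<in> V"
  shows "nrm (\<lambda>x. c * u x) = cmod c * nrm u"
proof -
  have "ip (\<lambda>x. c * u x) (\<lambda>x. c * u x) = (c * cnj c) * ip u u"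
    using assms scale_mem[OF assms, of c] by (simp add: ip_scale ip_scale2)
  then have "Re (ip (\<lambda>x. c * u x) (\<lambda>x. c * u x)) = (cmod c)\<^sup>2 * Re (ip u u)"
    by (simp only: complex_norm_square[symmetric]) simp
  then show ?thesis
    by (simp add: nrm_def real_sqrt_mult)
qed

lemma Cauchy_Schwarz:
  assumes "u \<in> V" "v \<in> V"
  shows "cmod (ip u v) \<le> nrm u * nrm v"
proof (rule field_le_epsilon)
  fix e :: real assume "e > 0"
  define N where "N = (nrm v)\<^sup>2"
  define G where "G = (cmod (ip u v))\<^sup>2"
  have N: "N \<ge> 0" by (simp add: N_def)
  \<comment> \<open>Nonnegativity of the squared seminorm of \<open>u - s (ip u v) v\<close>, for
    every real \<open>s\<close>.\<close>
  have main: "2 * s * G \<le> (nrm u)\<^sup>2 + s\<^sup>2 * G * N" for s :: real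
  proof -
    define c where "c = of_real (- s) * ip u v"
    have "cnj c * ip u v = of_real (- s) * (ip u v * cnj (ip u v))"
      by (simp add: c_def)
    then have "cnj c * ip u v = of_real (- s * G)"
      by (simp only: complex_norm_square[symmetric] G_def) simp
    then have "Re (cnj c * ip u v) = - s * G" by (metis Re_complex_of_real)
    moreover have "(cmod c)\<^sup>2 = s\<^sup>2 * G"
      by (simp add: c_def G_def norm_mult power_mult_distrib)
    ultimately have "(nrm (\<lambda>x. u x + c * v x))\<^sup>2 = (nrm u)\<^sup>2 - 2 * s * G + s\<^sup>2 * G * N"
      using nrm_sq_add_scale[OF assms, of c] by (simp add: N_def)
    then show ?thesis using zero_le_power2[of "nrm (\<lambda>x. u x + c * v x)"] by linarith
  qed
  have "G \<le> (nrm u)\<^sup>2 * N"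
  \<comment> \<open>A function of seminorm zero need not vanish, so this case is separate: the
    estimate is then linear in \<open>s\<close>, and a large \<open>s\<close> forces
    \<open>G = 0\<close>. Otherwise \<open>s = 1 / N\<close> is the optimal choice.\<close>
  proof (cases "N = 0")
    case True
    have "G = 0"
    proof (rule ccontr)
      assume "G \<noteq> 0"
      then have "G > 0" by (simp add: G_def)
      with main[of "((nrm u)\<^sup>2 + 1) / G"] True show False
        using zero_le_power2[of "nrm u"] by simp
    qed
    then show ?thesis using True by simp
  next
    case False
    then have "N > 0" using N by simp
    with main[of "1 / N"] show ?thesis by (simp add: field_simps power2_eq_square)
  qed
  then have "cmod (ip u v) \<le> nrm u * nrm v"
    unfolding G_def N_def power_mult_distrib[symmetric]
    by (rule power2_le_imp_le) (simp add: nrm_nonneg assms)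
  then show "cmod (ip u v) \<le> nrm u * nrm v + e" using \<open>e > 0\<close> by simp
qed

lemma nrm_triangle:
  assumes "u \<in> V" "v \<in> V"
  shows "nrm (\<lambda>x. u x + v x) \<le> nrm u + nrm v"
proof (rule power2_le_imp_le)
  have "Re (ip u v) \<le> nrm u * nrm v"
    using Cauchy_Schwarz[OF assms] complex_Re_le_cmod order_trans by blast
  then show "(nrm (\<lambda>x. u x + v x))\<^sup>2 \<le> (nrm u + nrm v)\<^sup>2"
    using nrm_sq_add_scale[OF assms, of 1] by (simp add: power2_sum)
  show "0 \<le> nrm u + nrm v" using assms by (simp add: nrm_nonneg)
qed

text \<open>The representing element minimises \<open>\<parallel>u\<parallel>\<^sup>2 - 2 Re (F u)\<close>; the parallelogram identity makes
  minimising sequences Cauchy.\<close>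

theorem Riesz_representation:
  assumes ne: "V \<noteq> {}"
    and F_add: "\<And>u v. u \<in> V \<Longrightarrow> v \<in> V \<Longrightarrow> F (\<lambda>x. u x + v x) = F u + F v"
    and F_scale: "\<And>c u. u \<in> V \<Longrightarrow> F (\<lambda>x. c * u x) = cnj c * F u"
    and F_bound: "\<And>u. u \<in> V \<Longrightarrow> cmod (F u) \<le> C * nrm u"
    and complete: "\<And>f. (\<And>n. f n \<in> V) \<Longrightarrow>
        (\<And>m n. n \<le> m \<Longrightarrow> nrm (\<lambda>x. f m x - f n x) \<le> (1/2) ^ n) \<Longrightarrow>
        \<exists>w\<in>V. (\<lambda>n. nrm (\<lambda>x. f n x - w x)) \<longlonglongrightarrow> 0"
  shows "\<exists>w\<in>V. \<forall>\<phi>\<in>V. ip w \<phi> = F \<phi>"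
proof -
  define J where "J u = (nrm u)\<^sup>2 - 2 * Re (F u)" for u
  \<comment> \<open>The first order term carries \<open>ip u v - F v\<close>, so stationarity of
    \<open>J\<close> at \<open>u\<close> is exactly the representation property.\<close>
  have J_add: "J (\<lambda>x. u x + c * v x) =
      J u + 2 * Re (cnj c * (ip u v - F v)) + (cmod c)\<^sup>2 * (nrm v)\<^sup>2"
    if "u \<in> V" "v \<in> V" for u v c
    using that nrm_sq_add_scale[OF that] scale_mem[OF that(2)]
    by (simp add: J_def F_add F_scale algebra_simps)
  have bdd: "bdd_below (J ` V)"
  \<comment> \<open>Completing the square: \<open>J u\<close> is at least
    \<open>(nrm u - C)^2 - C^2\<close>.\<close>
  proof (rule bdd_belowI2)
    fix u assume u: "u \<in> V"
    have "Re (F u) \<le> C * nrm u"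
      using F_bound[OF u] complex_Re_le_cmod order_trans by blast
    moreover have "0 \<le> (nrm u - C)\<^sup>2" by simp
    ultimately show "- C\<^sup>2 \<le> J u" by (simp add: J_def power2_diff mult.commute)
  qed
  define m where "m = Inf (J ` V)"
  have m_le: "m \<le> J u" if "u \<in> V" for u
    unfolding m_def using bdd that by (intro cInf_lower) auto
  \<comment> \<open>For \<open>j <= i\<close>, comparing \<open>J\<close> at \<open>f i\<close>, at
    \<open>f j\<close> and at their midpoint bounds the squared seminorm of \<open>f i - f j\<close>
    by 2 (J (f i) + J (f j) - 2 m). The excess (1/4)^n / 4 makes this at most (1/4)^j, the square of
    the rate that \<open>complete\<close> asks for.\<close>
  have "\<exists>u\<in>V. J u < m + (1/4) ^ n / 4" for n :: nat
    using cInf_lessD[of "J ` V" "m + (1/4) ^ n / 4"] ne by (auto simp: m_def)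
  then obtain f where f: "\<And>n. f n \<in> V" "\<And>n :: nat. J (f n) < m + (1/4) ^ n / 4"
    by metis
  have "nrm (\<lambda>x. f i x - f j x) \<le> (1/2) ^ j" if "j \<le> i" for i j
  proof (rule power2_le_imp_le)
    have h: "(\<lambda>x. f j x + (1/2) * (f i x - f j x)) \<in> V"
      by (intro add_mem scale_mem diff_mem f)
    define d where "d = (\<lambda>x. f i x - f j x)"
    have dV: "d \<in> V" unfolding d_def by (intro diff_mem f)
    have e1: "J (f i) = J (f j) + 2 * Re (ip (f j) d - F d) + (nrm d)\<^sup>2"
      using J_add[OF f(1)[of j] dV, of 1] by (simp add: d_def)
    have e2: "m \<le> J (f j) + Re (ip (f j) d - F d) + (nrm d)\<^sup>2 / 4"
      using J_add[OF f(1)[of j] dV, of "1/2"] m_le[OF h] by (simp add: d_def power2_eq_square diff_divide_distrib)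
    have "(1/4::real) ^ i \<le> (1/4) ^ j" using that by (intro power_decreasing) auto
    moreover have "((1/2::real) ^ j)\<^sup>2 = (1/4) ^ j"
      by (simp add: power2_eq_square flip: power_mult_distrib)
    ultimately show "(nrm (\<lambda>x. f i x - f j x))\<^sup>2 \<le> ((1/2) ^ j)\<^sup>2"
      using e1 e2 f(2)[of i] f(2)[of j] unfolding d_def[symmetric] by linarith
  qed auto
  from complete[OF f(1) this] obtain w where w: "w \<in> V" "(\<lambda>n. nrm (\<lambda>x. f n x - w x)) \<longlonglongrightarrow> 0"
    by blast
  have "J w \<le> m"
  proof (rule LIMSEQ_le_const)
    let ?e = "\<lambda>n. nrm (\<lambda>x. f n x - w x)"
    show "(\<lambda>n. m + (1/4) ^ n / 4 + 2 * (nrm w * ?e n + C * ?e n)) \<longlonglongrightarrow> m"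
      by (rule tendsto_eq_intros w(2) LIMSEQ_power_zero | simp)+
    show "\<exists>N. \<forall>n\<ge>N. J w \<le> m + (1/4) ^ n / 4 + 2 * (nrm w * ?e n + C * ?e n)"
    proof (intro exI allI impI)
      fix n
      define d where "d = (\<lambda>x. f n x - w x)"
      have dV: "d \<in> V" unfolding d_def by (intro diff_mem f w)
      have "J (f n) = J w + 2 * Re (ip w d - F d) + (nrm d)\<^sup>2"
        using J_add[OF w(1) dV, of 1] by (simp add: d_def)
      moreover have "- Re (ip w d - F d) \<le> nrm w * nrm d + C * nrm d"
        using abs_Re_le_cmod[of "ip w d - F d"] norm_triangle_ineq4[of "ip w d" "F d"]
          Cauchy_Schwarz[OF w(1) dV] F_bound[OF dV] by linarith
      ultimately show "J w \<le> m + (1/4) ^ n / 4 + 2 * (nrm w * ?e n + C * ?e n)"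
        using f(2)[of n] zero_le_power2[of "nrm d"] unfolding d_def[symmetric]
        by (smt (verit))
    qed
  qed
  have "ip w \<phi> = F \<phi>" if \<phi>: "\<phi> \<in> V" for \<phi>
  proof (rule ccontr)
    assume ne: "ip w \<phi> \<noteq> F \<phi>"
    define G where "G = ip w \<phi> - F \<phi>"
    \<comment> \<open>Step length in the descent direction \<open>- G\<close>. The change of
      \<open>J\<close> is |G|^2 s (s (nrm \<phi>)^2 - 2), negative as soon as s (nrm \<phi>)^2 < 2;
      the summand 1 covers \<open>\<phi>\<close> of seminorm zero.\<close>
    define s where "s = 1 / ((nrm \<phi>)\<^sup>2 + 1)"
    define c where "c = of_real (- s) * G"
    have "(nrm \<phi>)\<^sup>2 + 1 > 0" by (simp add: add_nonneg_pos)
    then have s: "s > 0" "s * (nrm \<phi>)\<^sup>2 < 2"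
      by (simp_all add: s_def pos_divide_less_eq)
    have G: "(cmod G)\<^sup>2 > 0" using ne by (simp add: G_def)
    have "cnj c * G = of_real (- s) * (G * cnj G)" by (simp add: c_def)
    then have "cnj c * G = of_real (- s * (cmod G)\<^sup>2)"
      by (simp only: complex_norm_square[symmetric]) simp
    then have "Re (cnj c * G) = - s * (cmod G)\<^sup>2" by (metis Re_complex_of_real)
    moreover have "(cmod c)\<^sup>2 = s\<^sup>2 * (cmod G)\<^sup>2"
      by (simp add: c_def norm_mult power_mult_distrib)
    moreover have "J w \<le> J (\<lambda>x. w x + c * \<phi> x)"
      using \<open>J w \<le> m\<close> m_le[of "\<lambda>x. w x + c * \<phi> x"] w \<phi> add_mem scale_mem by fastforce
    ultimately have "0 \<le> - 2 * s * (cmod G)\<^sup>2 + s\<^sup>2 * (cmod G)\<^sup>2 * (nrm \<phi>)\<^sup>2"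
      using J_add[OF w(1) \<phi>, of c] by (simp add: G_def)
    also have "\<dots> = (s * (cmod G)\<^sup>2) * (s * (nrm \<phi>)\<^sup>2 - 2)"
      by (simp add: algebra_simps power2_eq_square)
    also have "\<dots> < 0" using s G by (intro mult_pos_neg) auto
    finally show False by simp
  qed
  then show ?thesis using w(1) by blast
qed

end

section \<open>Bump functions and the fundamental lemma of the calculus of variations\<close>

lemma Ck_on_SucI:
  assumes "\<And>x. (f has_derivative f' x) (at x)" "\<And>v. Ck_on k UNIV (\<lambda>x. f' x v)"
  shows "Ck_on (Suc k) UNIV f"
proof -
  have "frechet_derivative f (at x) = f' x" for x
    using frechet_derivative_at[OF assms(1)] by simp
  then show ?thesis
    using assms by (auto simp: differentiable_def)
qed

lemma Ck_on_SucE: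
  assumes "Ck_on (Suc k) UNIV f"
  shows "(f has_derivative frechet_derivative f (at x)) (at x)"
    and "Ck_on k UNIV (\<lambda>x. frechet_derivative f (at x) v)"
  using assms by (auto simp: frechet_derivative_works[symmetric])

text \<open>\<open>Ck_on (Suc k)\<close> does not literally contain \<open>Ck_on k\<close>. The
  inclusion is what the product rule needs, where one factor stays undifferentiated while the order
  drops.\<close>

lemma Ck_on_Suc_imp: "Ck_on (Suc k) UNIV f \<Longrightarrow> Ck_on k UNIV f"
proof (induction k arbitrary: f)
  case 0
  then show ?case
    by (auto intro!: continuous_at_imp_continuous_on differentiable_imp_continuous_within)
next
  case (Suc k)
  show ?case
    using Suc.IH[OF Ck_on_SucE(2)[OF Suc.prems]] Ck_on_SucE(1)[OF Suc.prems]
    by (intro Ck_on_SucI)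
qed

lemma Ck_on_const: "Ck_on k UNIV (\<lambda>_. c)"
  by (induction k arbitrary: c) (auto intro!: Ck_on_SucI[where f' = "\<lambda>_ _. 0"] simp del: Ck_on.simps(2))

lemma Ck_on_add: "Ck_on k UNIV f \<Longrightarrow> Ck_on k UNIV g \<Longrightarrow> Ck_on k UNIV (\<lambda>x. f x + g x)"
proof (induction k arbitrary: f g)
  case 0
  then show ?case by (auto intro: continuous_intros)
next
  case (Suc k)
  show ?case
    by (rule Ck_on_SucI[OF has_derivative_add[OF Ck_on_SucE(1)[OF Suc.prems(1)] Ck_on_SucE(1)[OF Suc.prems(2)]]])
      (intro Suc.IH Ck_on_SucE(2)[OF Suc.prems(1)] Ck_on_SucE(2)[OF Suc.prems(2)])
qed

lemma Ck_on_mult: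
  fixes f g :: "_ \<Rightarrow> 'b::real_normed_algebra"
  shows "Ck_on k UNIV f \<Longrightarrow> Ck_on k UNIV g \<Longrightarrow> Ck_on k UNIV (\<lambda>x. f x * g x)"
proof (induction k arbitrary: f g)
  case 0
  then show ?case by (auto intro: continuous_intros)
next
  case (Suc k)
  show ?case
    by (rule Ck_on_SucI[OF has_derivative_mult[OF Ck_on_SucE(1)[OF Suc.prems(1)] Ck_on_SucE(1)[OF Suc.prems(2)]]])
      (intro Ck_on_add Suc.IH Ck_on_SucE(2)[OF Suc.prems(1)] Ck_on_SucE(2)[OF Suc.prems(2)]
        Ck_on_Suc_imp[OF Suc.prems(1)] Ck_on_Suc_imp[OF Suc.prems(2)])
qed

lemma Ck_on_prod:
  fixes f :: "'i \<Rightarrow> _ \<Rightarrow> 'b::{real_normed_algebra,comm_ring_1}"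
  assumes "finite I" "\<And>i. i \<in> I \<Longrightarrow> Ck_on k UNIV (f i)"
  shows "Ck_on k UNIV (\<lambda>x. \<Prod>i\<in>I. f i x)"
  using assms by (induction rule: finite_induct) (auto intro: Ck_on_const Ck_on_mult)

lemma Ck_on_of_real:
  fixes f :: "'a::euclidean_space \<Rightarrow> real"
  shows "Ck_on k UNIV f \<Longrightarrow> Ck_on k UNIV (\<lambda>x. complex_of_real (f x))"
proof (induction k arbitrary: f)
  case 0
  then show ?case by (auto intro: continuous_intros)
next
  case (Suc k)
  show ?case
    by (rule Ck_on_SucI[OF has_derivative_of_real[OF Ck_on_SucE(1)[OF Suc.prems(1)]]])
      (intro Suc.IH Ck_on_SucE(2)[OF Suc.prems(1)])
qed

text \<open>The classical smooth function exp (-1/t), extended by zero to t <= 0. The polynomial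
  factor in 1/t makes the family closed under differentiation.\<close>

definition flat_exp :: "real poly \<Rightarrow> real \<Rightarrow> real" where
  "flat_exp P t = (if t \<le> 0 then 0 else poly P (1 / t) * exp (- (1 / t)))"

lemma tendsto_poly_div_exp_0: "((\<lambda>x. poly P x / exp x) \<longlongrightarrow> (0::real)) at_top"
proof -
  have "((\<lambda>x. \<Sum>i\<le>degree P. coeff P i * (x ^ i / exp x)) \<longlongrightarrow> (\<Sum>i\<le>degree P. coeff P i * 0)) at_top"
    by (intro tendsto_intros tendsto_power_div_exp_0)
  then show ?thesis
    by (simp add: poly_altdef sum_divide_distrib)
qed

text \<open>In the variable s = 1/t, d/dt is - s^2 d/ds, and P(s) exp (-s) is sent to s^2 (P -
  P')(s) exp (-s). At t = 0 the exponential beats every power of 1/t.\<close>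

lemma flat_exp_has_field_derivative:
  "(flat_exp P has_field_derivative flat_exp ([:0, 0, 1:] * (P - pderiv P)) t) (at t)"
proof -
  consider "t < 0" | "t > 0" | "t = 0" by linarith
  then show ?thesis
  proof cases
    case 1
    have "((\<lambda>_. 0) has_field_derivative 0) (at t)" by simp
    then have "(flat_exp P has_field_derivative 0) (at t)"
      by (rule has_field_derivative_transform_within_open[where S = "{..<0}"])
        (use 1 in \<open>auto simp: flat_exp_def\<close>)
    then show ?thesis using 1 by (simp add: flat_exp_def)
  next
    case 2
    have "((\<lambda>t. poly P (1 / t) * exp (- (1 / t))) has_field_derivative
        (poly (pderiv P) (1 / t) * (- (1 / t\<^sup>2))) * exp (- (1 / t)) +
        (exp (- (1 / t)) * (1 / t\<^sup>2)) * poly P (1 / t)) (at t)"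
      using 2 by (auto intro!: derivative_eq_intros simp: power2_eq_square)
    then have "(flat_exp P has_field_derivative
        (poly (pderiv P) (1 / t) * (- (1 / t\<^sup>2))) * exp (- (1 / t)) +
        (exp (- (1 / t)) * (1 / t\<^sup>2)) * poly P (1 / t)) (at t)"
      by (rule has_field_derivative_transform_within_open[where S = "{0<..}"])
        (use 2 in \<open>auto simp: flat_exp_def\<close>)
    then show ?thesis using 2 by (simp add: flat_exp_def algebra_simps power2_eq_square)
  next
    case 3
    \<comment> \<open>\<open>pCons 0\<close> multiplies the polynomial by its variable 1/h, which is
      the denominator of the difference quotient at 0.\<close>
    have "((\<lambda>h. poly (pCons 0 P) (inverse h) / exp (inverse h)) \<longlongrightarrow> 0) (at_right 0)"
      by (rule filterlim_compose[OF tendsto_poly_div_exp_0 filterlim_inverse_at_top_right])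
    then have "((\<lambda>h. flat_exp P h / h) \<longlongrightarrow> 0) (at_right 0)"
      by (rule Lim_transform_eventually)
        (auto simp: eventually_at_filter flat_exp_def exp_minus field_simps)
    moreover have "((\<lambda>h. flat_exp P h / h) \<longlongrightarrow> 0) (at_left 0)"
      by (rule Lim_transform_eventually[OF tendsto_const])
        (auto simp: eventually_at_filter flat_exp_def)
    ultimately have "((\<lambda>h. flat_exp P h / h) \<longlongrightarrow> 0) (at 0)"
      by (simp add: filterlim_split_at)
    then show ?thesis
      using 3 by (simp add: DERIV_def flat_exp_def)
  qed
qed

text \<open>An affine inner map has constant derivative \<open>l\<close>, so differentiating only
  changes the polynomial and adds a constant factor; the induction therefore has to run over all
  \<open>P\<close> at once.\<close>

lemma Ck_on_flat_exp:
  fixes l :: "'a::euclidean_space \<Rightarrow> real"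
  assumes "bounded_linear l"
  shows "Ck_on k UNIV (\<lambda>x. flat_exp P (l x + c))"
proof (induction k arbitrary: P)
  have der: "((\<lambda>x. flat_exp P (l x + c)) has_derivative
      (\<lambda>v. flat_exp ([:0, 0, 1:] * (P - pderiv P)) (l x + c) * l v)) (at x)" for P x
  proof -
    have "((\<lambda>x. l x + c) has_derivative l) (at x)"
      using has_derivative_add[OF bounded_linear_imp_has_derivative[OF assms] has_derivative_const[of c]]
      by simp
    from has_derivative_compose[OF this, of "flat_exp P"] flat_exp_has_field_derivative[of P "l x + c"]
    show ?thesis by (auto simp: has_field_derivative_def)
  qed
  {
    case 0
    show ?case
      using der[of P] by (auto intro!: continuous_at_imp_continuous_on has_derivative_continuous)
  next
    case (Suc k)
    show ?case
      by (rule Ck_on_SucI[OF der]) (intro Ck_on_mult Ck_on_const Suc.IH)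
  }
qed

text \<open>The shift by \<open>1\<close> keeps the support compactly inside the open box, while the factor \<open>m\<close> makes the
  bumps converge to its indicator function.\<close>

definition box_bump :: "'a::euclidean_space \<Rightarrow> 'a \<Rightarrow> nat \<Rightarrow> 'a \<Rightarrow> real" where
  "box_bump a b m x = (\<Prod>i\<in>Basis. flat_exp 1 (real m * ((x - a) \<bullet> i) - 1) * flat_exp 1 (real m * ((b - x) \<bullet> i) - 1))"

lemma Ck_on_box_bump: "Ck_on k UNIV (box_bump a b m)"
proof -
  have "Ck_on k UNIV (\<lambda>x. flat_exp 1 (real m * ((x - a) \<bullet> i) - 1))"
    and "Ck_on k UNIV (\<lambda>x. flat_exp 1 (real m * ((b - x) \<bullet> i) - 1))" for i
    using Ck_on_flat_exp[of "\<lambda>x. real m * (x \<bullet> i)" k 1 "- real m * (a \<bullet> i) - 1"]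
      Ck_on_flat_exp[of "\<lambda>x. - real m * (x \<bullet> i)" k 1 "real m * (b \<bullet> i) - 1"]
    by (simp_all add: algebra_simps bounded_linear_minus bounded_linear_const_mult bounded_linear_inner_left)
  then show ?thesis
    unfolding box_bump_def by (intro Ck_on_prod Ck_on_mult) auto
qed

lemma flat_exp_1_bounds: "0 \<le> flat_exp 1 t" "flat_exp 1 t \<le> 1"
  by (auto simp: flat_exp_def)

lemma box_bump_bounds: "0 \<le> box_bump a b m x" "box_bump a b m x \<le> 1"
  unfolding box_bump_def
  by (auto intro!: prod_nonneg prod_le_1 mult_nonneg_nonneg mult_le_one flat_exp_1_bounds)

lemma box_bump_nonzero:
  assumes "box_bump a b m x \<noteq> 0" "i \<in> Basis"
  shows "1 < real m * ((x - a) \<bullet> i)" "1 < real m * ((b - x) \<bullet> i)"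
proof -
  have "flat_exp 1 (real m * ((x - a) \<bullet> i) - 1) * flat_exp 1 (real m * ((b - x) \<bullet> i) - 1) \<noteq> 0"
    using assms by (auto simp: box_bump_def)
  then show "1 < real m * ((x - a) \<bullet> i)" "1 < real m * ((b - x) \<bullet> i)"
    by (auto simp: flat_exp_def split: if_splits)
qed

lemma box_bump_test_function:
  assumes "box a b \<subseteq> D"
  shows "(\<lambda>x. complex_of_real (box_bump a b m x)) \<in> test_functions D"
proof -
  \<comment> \<open>A closed set between the bump's nonzero set and the open box: the shift gives
    \<open>1 < m t\<close> for each distance \<open>t\<close> to a face, the closure keeps
    \<open>1 <= m t\<close>, and this still forces \<open>t > 0\<close>.\<close>
  define K where "K = {x. \<forall>i\<in>Basis. 1 \<le> real m * ((x - a) \<bullet> i) \<and> 1 \<le> real m * ((b - x) \<bullet> i)}"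
  have "closed K"
    unfolding K_def Ball_def
    by (intro closed_Collect_all closed_Collect_imp closed_Collect_conj closed_Collect_le continuous_intros open_Collect_const)
  have "{x. complex_of_real (box_bump a b m x) \<noteq> 0} \<subseteq> K"
    using box_bump_nonzero[of a b m] by (force simp: K_def)
  then have "closure {x. complex_of_real (box_bump a b m x) \<noteq> 0} \<subseteq> K"
    using \<open>closed K\<close> by (rule closure_minimal)
  moreover have "K \<subseteq> box a b"
  proof
    fix x assume x: "x \<in> K"
    have "a \<bullet> i < x \<bullet> i \<and> x \<bullet> i < b \<bullet> i" if "i \<in> Basis" for i
    proof -
      have "0 < real m * ((x - a) \<bullet> i)" "0 < real m * ((b - x) \<bullet> i)"
        using x that by (auto simp: K_def intro: less_le_trans[of 0 1])
      then show ?thesis by (auto simp: zero_less_mult_iff inner_diff_left)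
    qed
    then show "x \<in> box a b" by (simp add: mem_box)
  qed
  moreover from this have "bounded K"
    using bounded_box bounded_subset by blast
  ultimately have "compact (closure {x. complex_of_real (box_bump a b m x) \<noteq> 0})"
      "closure {x. complex_of_real (box_bump a b m x) \<noteq> 0} \<subseteq> D"
    using assms by (auto simp: compact_eq_bounded_closed intro: bounded_subset)
  then show ?thesis
    by (auto simp: test_functions_def smooth_def intro: Ck_on_of_real Ck_on_box_bump)
qed

text \<open>Inside the box every factor is eventually exp (-1 / (m t - 1)) with t > 0 and tends to
  1; outside, some face distance is nonpositive and its factor is zero for every
  \<open>m\<close>.\<close>

lemma box_bump_tendsto:
  "(\<lambda>m. box_bump a b m x) \<longlonglongrightarrow> indicator (box a b) x"
proof (cases "x \<in> box a b")
  case True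
  have lim: "(\<lambda>m. flat_exp 1 (real m * t - 1)) \<longlonglongrightarrow> 1" if "t > 0" for t
  proof -
    have top: "filterlim (\<lambda>m. real m * t - 1) at_top sequentially"
      using that by real_asymp
    then have "(\<lambda>m. exp (- (1 / (real m * t - 1)))) \<longlonglongrightarrow> 1"
      using that by real_asymp
    moreover have "\<forall>\<^sub>F m in sequentially. exp (- (1 / (real m * t - 1))) = flat_exp 1 (real m * t - 1)"
      using top[unfolded filterlim_at_top_dense, rule_format, of 0]
      by eventually_elim (auto simp: flat_exp_def)
    ultimately show ?thesis by (rule Lim_transform_eventually)
  qed
  have "(\<lambda>m. box_bump a b m x) \<longlonglongrightarrow> (\<Prod>i\<in>(Basis::'a set). 1 * 1)"
    unfolding box_bump_def using True
    by (intro tendsto_prod tendsto_mult lim) (auto simp: mem_box inner_diff_left)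
  then show ?thesis using True by simp
next
  case False
  then obtain i where i: "i \<in> Basis" "(x - a) \<bullet> i \<le> 0 \<or> (b - x) \<bullet> i \<le> 0"
    by (force simp: mem_box inner_diff_left)
  have "box_bump a b m x = 0" for m
  proof (rule ccontr)
    assume "box_bump a b m x \<noteq> 0"
    from box_bump_nonzero[OF this i(1)] i(2) show False
      by (smt (verit) mult_nonneg_nonpos of_nat_0_le_iff)
  qed
  then show ?thesis using False by simp
qed

text \<open>Test against the bumps of the box and let \<open>m\<close> grow: they lie between 0 and
  1, so \<open>norm g\<close> dominates the integrands.\<close>

lemma integral_box_eq_0:
  fixes g :: "'a::euclidean_space \<Rightarrow> complex"
  assumes "open D" "integrable (lebesgue_on D) g"
    and zero: "\<And>\<phi>. \<phi> \<in> test_functions D \<Longrightarrow> (LINT x|lebesgue_on D. g x * \<phi> x) = 0"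
    and "box a b \<subseteq> D"
  shows "(LINT x:box a b|lebesgue_on D. g x) = 0"
proof -
  have meas: "box_bump a b m \<in> borel_measurable (lebesgue_on D)" for m
    using Ck_on_box_bump[of 0 a b m] assms(1)
    by (intro continuous_imp_measurable_on_sets_lebesgue) (auto intro: continuous_on_subset)
  have box: "box a b \<in> sets (lebesgue_on D)"
    using assms by (subst sets_restrict_space_iff) auto
  have "(\<lambda>m. LINT x|lebesgue_on D. g x * box_bump a b m x) \<longlonglongrightarrow> (LINT x|lebesgue_on D. g x * indicator (box a b) x)"
  proof (rule integral_dominated_convergence[where w = "\<lambda>x. norm (g x)"])
    show "AE x in lebesgue_on D. norm (g x * complex_of_real (box_bump a b m x)) \<le> norm (g x)" for m
      by (auto simp: norm_mult intro!: mult_left_le box_bump_bounds simp: box_bump_bounds)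
    show "AE x in lebesgue_on D. (\<lambda>m. g x * complex_of_real (box_bump a b m x)) \<longlonglongrightarrow> g x * indicator (box a b) x"
      using tendsto_mult[OF tendsto_const[of "g _"] tendsto_of_real[OF box_bump_tendsto[of a b]]]
      by (intro AE_I2) (simp add: of_real_indicator)
  qed (use assms meas box in \<open>auto intro!: borel_measurable_times borel_measurable_indicator borel_measurable_of_real\<close>)
  then have "(LINT x|lebesgue_on D. g x * indicator (box a b) x) = 0"
    by (simp add: zero[OF box_bump_test_function[OF assms(4)]] LIMSEQ_const_iff)
  moreover have "(LINT x:box a b|lebesgue_on D. g x) = (LINT x|lebesgue_on D. g x * indicator (box a b) x)"
    unfolding set_lebesgue_integral_def by (intro Bochner_Integration.integral_cong) (auto simp: indicator_def)
  ultimately show ?thesis by simp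
qed


text \<open>Open boxes form an intersection-stable generator of the Borel sets. Cutting with one
  fixed box inside \<open>D\<close> keeps every generator inside \<open>D\<close>, and complements
  are then taken within that box, whose own integral is zero.\<close>

lemma integral_borel_Int_box_eq_0:
  fixes g :: "'a::euclidean_space \<Rightarrow> complex"
  assumes "open D" and g: "integrable (lebesgue_on D) g"
    and zero: "\<And>\<phi>. \<phi> \<in> test_functions D \<Longrightarrow> (LINT x|lebesgue_on D. g x * \<phi> x) = 0"
    and "box a b \<subseteq> D" "A \<in> sets borel"
  shows "(LINT x:A \<inter> box a b|lebesgue_on D. g x) = 0"
proof -
  have sets: "S \<inter> box a b \<in> sets (lebesgue_on D)" if "S \<in> sets borel" for S
    using assms that by (subst sets_restrict_space_iff) (auto intro: borel_open)
  have int: "set_integrable (lebesgue_on D) S g" if "S \<in> sets (lebesgue_on D)" for S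
    using that g integrable_mult_indicator set_integrable_def by blast
  have "Int_stable (range (\<lambda>(a, b). box a b :: 'a set))"
    by (auto simp: Int_stable_def box_Int_box)
  moreover have "range (\<lambda>(a, b). box a b :: 'a set) \<subseteq> Pow UNIV" by auto
  moreover have "A \<in> sigma_sets UNIV (range (\<lambda>(a, b). box a b))"
    using assms(5) unfolding borel_eq_box by simp
  ultimately show ?thesis
  proof (induction rule: sigma_sets_induct_disjoint)
    case (basic S)
    then obtain c d where "S = box c d" by auto
    then show ?case
      using assms(4) unfolding box_Int_box
      by (simp add: box_Int_box) (rule integral_box_eq_0[OF assms(1) g zero], auto simp: box_Int_box[symmetric])
  next
    case empty
    then show ?case by (simp add: set_lebesgue_integral_def)
  next
    case (compl S)
    then have S: "S \<in> sets borel" by (simp add: borel_eq_box)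
    have "(LINT x:(S \<inter> box a b) \<union> ((UNIV - S) \<inter> box a b)|lebesgue_on D. g x) =
        (LINT x:S \<inter> box a b|lebesgue_on D. g x) + (LINT x:(UNIV - S) \<inter> box a b|lebesgue_on D. g x)"
      using S by (intro set_integral_Un int sets) auto
    moreover have "(S \<inter> box a b) \<union> ((UNIV - S) \<inter> box a b) = box a b" by auto
    ultimately show ?case
      using compl integral_box_eq_0[OF assms(1) g zero assms(4)] by simp
  next
    case (union F)
    then have F: "\<And>i. F i \<in> sets borel" by (simp add: borel_eq_box subset_eq)
    have "(LINT x:(\<Union>i. F i \<inter> box a b)|lebesgue_on D. g x) = (\<Sum>i. LINT x:F i \<inter> box a b|lebesgue_on D. g x)"
      using union(1) F by (intro lebesgue_integral_countable_add int sets sets.countable_UN)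
        (auto simp: disjoint_family_on_def intro!: sets)
    moreover have "(\<Union>i. F i \<inter> box a b) = (\<Union>(range F)) \<inter> box a b" by auto
    ultimately show ?case using union by simp
  qed
qed

theorem fundamental_lemma_of_calculus_of_variations:
  fixes g :: "'a::euclidean_space \<Rightarrow> complex"
  assumes "open D" and g: "integrable (lebesgue_on D) g"
    and zero: "\<And>\<phi>. \<phi> \<in> test_functions D \<Longrightarrow> (LINT x|lebesgue_on D. g x * \<phi> x) = 0"
  shows "AE x in lebesgue_on D. g x = 0"
proof -
  let ?M = "lebesgue_on D"
  have Ds: "D \<in> sets lebesgue" using assms(1) by auto
  have local: "AE x in ?M. x \<in> box a b \<longrightarrow> g x = 0" if "box a b \<subseteq> D" for a b
  proof -
    let ?f = "\<lambda>x. indicator (box a b) x *\<^sub>R g x"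
    have box: "box a b \<in> sets ?M"
      using Ds that by (subst sets_restrict_space_iff) auto
    have f: "integrable ?M ?f" using integrable_mult_indicator[OF box g] .
    have int0: "(LINT x:A|?M. ?f x) = 0" if A: "A \<in> sets ?M" for A
    proof -
      have "A \<in> sets lebesgue" using A Ds by (simp add: sets_restrict_space_iff)
      \<comment> \<open>A Lebesgue set is a Borel set up to a subset of a null set, so the Borel
        case carries over.\<close>
      then obtain S N N' where SN: "A = S \<union> N" "N \<subseteq> N'" "N' \<in> null_sets lborel" "S \<in> sets borel"
        by (elim sets_completionE) auto
      have "AE x in lebesgue. x \<notin> N'"
        using SN(3) by (intro AE_not_in null_sets_completionI)
      then have ae: "AE x in ?M. x \<notin> N'"
        using Ds by (simp add: AE_restrict_space_iff) (elim AE_mp, simp)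
      have SB: "S \<inter> box a b \<in> sets ?M"
        using SN(4) Ds \<open>box a b \<subseteq> D\<close> by (subst sets_restrict_space_iff) auto
      have "(LINT x:A|?M. ?f x) = (LINT x|?M. indicator (S \<inter> box a b) x *\<^sub>R g x)"
        unfolding set_lebesgue_integral_def
      proof (rule integral_cong_AE)
        show "AE x in ?M. indicator A x *\<^sub>R ?f x = indicator (S \<inter> box a b) x *\<^sub>R g x"
          using ae by eventually_elim (use SN in \<open>auto simp: indicator_def\<close>)
      qed (use A box g SB in \<open>auto intro!: borel_measurable_scaleR borel_measurable_times borel_measurable_indicator\<close>)
      also have "\<dots> = 0"
        using integral_borel_Int_box_eq_0[OF assms(1) g zero \<open>box a b \<subseteq> D\<close> SN(4)]
        by (simp add: set_lebesgue_integral_def)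
      finally show ?thesis .
    qed
    have fA: "integrable ?M (\<lambda>x. indicator A x *\<^sub>R ?f x)" if "A \<in> sets ?M" for A
      using integrable_mult_indicator[OF that f] .
    \<comment> \<open>The real part has the same integrals over all measurable sets as the density
      0, hence equals it almost everywhere; likewise the imaginary part.\<close>
    have "AE x in ?M. Re (?f x) = 0"
    proof (rule density_unique_real)
      fix A assume A: "A \<in> sets ?M"
      have "(LINT x:A|?M. Re (?f x)) = Re (LINT x:A|?M. ?f x)"
        unfolding set_lebesgue_integral_def by (subst integral_Re[OF fA[OF A], symmetric]) (simp add: mult.assoc)
      then show "(LINT x:A|?M. Re (?f x)) = (LINT x:A|?M. 0)"
        using int0[OF A] by (simp add: set_lebesgue_integral_def)
    qed (rule integrable_Re[OF f], simp)
    moreover have "AE x in ?M. Im (?f x) = 0"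
    proof (rule density_unique_real)
      fix A assume A: "A \<in> sets ?M"
      have "(LINT x:A|?M. Im (?f x)) = Im (LINT x:A|?M. ?f x)"
        unfolding set_lebesgue_integral_def by (subst integral_Im[OF fA[OF A], symmetric]) (simp add: mult.assoc)
      then show "(LINT x:A|?M. Im (?f x)) = (LINT x:A|?M. 0)"
        using int0[OF A] by (simp add: set_lebesgue_integral_def)
    qed (rule integrable_Im[OF f], simp)
    ultimately show ?thesis
      by eventually_elim (auto simp: complex_eq_iff)
  qed
  \<comment> \<open>Countably many boxes cover \<open>D\<close>, so the exceptional sets of the
    local statements unite to a null set.\<close>
  obtain \<D> where \<D>: "countable \<D>" "\<D> \<subseteq> Pow D" "\<And>X. X \<in> \<D> \<Longrightarrow> \<exists>a b. X = box a b" "\<Union>\<D> = D"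
    using open_countable_Union_open_box[OF assms(1)] by metis
  have "AE x in ?M. \<forall>X\<in>\<D>. x \<in> X \<longrightarrow> g x = 0"
  proof (subst AE_ball_countable[OF \<D>(1)], intro ballI)
    fix X assume "X \<in> \<D>"
    then show "AE x in ?M. x \<in> X \<longrightarrow> g x = 0"
      using \<D>(2,3) local by blast
  qed
  moreover have "AE x in ?M. x \<in> D"
    by (intro AE_I2) (simp add: space_restrict_space)
  ultimately show ?thesis
    by eventually_elim (use \<D>(4) in auto)
qed

section \<open>Square integrable functions\<close>

definition L2_norm :: "'a measure \<Rightarrow> ('a \<Rightarrow> complex) \<Rightarrow> real" where
  "L2_norm M f = sqrt (LINT x|M. (norm (f x))\<^sup>2)"

lemma borel_measurable_cnj [measurable]:
  "f \<in> borel_measurable M \<Longrightarrow> (\<lambda>x. cnj (f x)) \<in> borel_measurable M"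
  by (rule borel_measurable_continuous_on[OF continuous_on_cnj[OF continuous_on_id]])

lemma L2_mult_cnj_integrable:
  assumes "f \<in> L2 M" "g \<in> L2 M"
  shows "integrable M (\<lambda>x. f x * cnj (g x))"
proof (rule Bochner_Integration.integrable_bound)
  show "integrable M (\<lambda>x. (norm (f x))\<^sup>2 + (norm (g x))\<^sup>2)"
    using assms by (auto simp: L2_def)
  have [measurable]: "f \<in> borel_measurable M" "g \<in> borel_measurable M"
    using assms by (auto simp: L2_def)
  show "(\<lambda>x. f x * cnj (g x)) \<in> borel_measurable M" by measurable
  have "norm (f x * cnj (g x)) \<le> norm ((norm (f x))\<^sup>2 + (norm (g x))\<^sup>2)" for x
  proof -
    have "0 \<le> (norm (f x) - norm (g x))\<^sup>2" "0 \<le> (norm (f x))\<^sup>2" "0 \<le> (norm (g x))\<^sup>2" by simp_all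
    moreover have "norm (f x * cnj (g x)) = norm (f x) * norm (g x)" by (simp add: norm_mult)
    ultimately show ?thesis unfolding power2_diff real_norm_def by linarith
  qed
  then show "AE x in M. norm (f x * cnj (g x)) \<le> norm ((norm (f x))\<^sup>2 + (norm (g x))\<^sup>2)" by simp
qed

lemma L2_add:
  assumes "f \<in> L2 M" "g \<in> L2 M"
  shows "(\<lambda>x. f x + g x) \<in> L2 M"
proof -
  have [measurable]: "f \<in> borel_measurable M" "g \<in> borel_measurable M"
    using assms by (auto simp: L2_def)
  have "integrable M (\<lambda>x. (norm (f x + g x))\<^sup>2)"
  proof (rule Bochner_Integration.integrable_bound)
    show "integrable M (\<lambda>x. 2 * (norm (f x))\<^sup>2 + 2 * (norm (g x))\<^sup>2)"
      using assms by (auto simp: L2_def)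
    have "(norm (f x + g x))\<^sup>2 \<le> 2 * (norm (f x))\<^sup>2 + 2 * (norm (g x))\<^sup>2" for x
    proof -
      have "(norm (f x + g x))\<^sup>2 \<le> (norm (f x) + norm (g x))\<^sup>2"
        by (intro power_mono norm_triangle_ineq) auto
      moreover have "0 \<le> (norm (f x) - norm (g x))\<^sup>2" by simp
      ultimately show ?thesis unfolding power2_diff power2_sum by linarith
    qed
    then show "AE x in M. norm ((norm (f x + g x))\<^sup>2) \<le> norm (2 * (norm (f x))\<^sup>2 + 2 * (norm (g x))\<^sup>2)"
      by simp
  qed measurable
  then show ?thesis by (simp add: L2_def)
qed

lemma L2_bounded_mult:
  assumes "f \<in> L2 M" and [measurable]: "q \<in> borel_measurable M" and "AE x in M. norm (q x) \<le> K"
  shows "(\<lambda>x. q x * f x) \<in> L2 M"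
proof -
  have [measurable]: "f \<in> borel_measurable M"
    using assms by (auto simp: L2_def)
  have "integrable M (\<lambda>x. (norm (q x * f x))\<^sup>2)"
  proof (rule Bochner_Integration.integrable_bound)
    show "integrable M (\<lambda>x. K\<^sup>2 * (norm (f x))\<^sup>2)"
      using assms by (auto simp: L2_def)
    show "AE x in M. norm ((norm (q x * f x))\<^sup>2) \<le> norm (K\<^sup>2 * (norm (f x))\<^sup>2)"
      using assms(3) by eventually_elim (auto simp: norm_mult power_mult_distrib intro!: mult_right_mono power_mono)
  qed measurable
  then show ?thesis by (simp add: L2_def)
qed

lemma L2_scale: "f \<in> L2 M \<Longrightarrow> (\<lambda>x. c * f x) \<in> L2 M"
  by (rule L2_bounded_mult[where K = "norm c"]) auto

lemma L2_inner_self: "L2_inner M f f = of_real (LINT x|M. (norm (f x))\<^sup>2)"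
  unfolding L2_inner_def complex_norm_square[symmetric] by (rule integral_complex_of_real)

interpretation L2: semi_inner "L2 M" "L2_inner M"
  rewrites "semi_inner.nrm (L2_inner M) = L2_norm M"
  for M :: "'a measure"
proof -
  show *: "semi_inner (L2 M) (L2_inner M)"
  proof
    show "L2_inner M v u = cnj (L2_inner M u v)" for u v
      unfolding L2_inner_def by (subst Bochner_Integration.integral_cnj[symmetric]) (simp add: mult.commute)
  qed (auto simp: L2_add L2_scale L2_inner_self L2_inner_def L2_mult_cnj_integrable distrib_right
      mult.assoc)
  show "semi_inner.nrm (L2_inner M) = L2_norm M"
    by (auto simp: semi_inner.nrm_def[OF *] L2_norm_def L2_inner_self)
qed

lemma L2_inner_cong_AE:
  assumes "f \<in> L2 M" "g \<in> L2 M" "f' \<in> borel_measurable M" "g' \<in> borel_measurable M"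
    "AE x in M. f x = f' x" "AE x in M. g x = g' x"
  shows "L2_inner M f g = L2_inner M f' g'"
proof -
  have [measurable]: "f \<in> borel_measurable M" "g \<in> borel_measurable M"
    using assms by (auto simp: L2_def)
  note assms(3,4)[measurable]
  have "AE x in M. f x * cnj (g x) = f' x * cnj (g' x)"
    using assms(5,6) by eventually_elim simp
  then show ?thesis
    unfolding L2_inner_def by (intro integral_cong_AE) auto
qed

lemma L2_norm_cong_AE:
  assumes "f \<in> L2 M" "f' \<in> borel_measurable M" "AE x in M. f x = f' x"
  shows "L2_norm M f = L2_norm M f'"
  using L2_inner_cong_AE[OF assms(1,1,2,2,3,3)] by (simp add: L2_norm_def L2_inner_self)

lemma L2_norm_bounded_mult:
  assumes "f \<in> L2 M" and [measurable]: "q \<in> borel_measurable M" and "AE x in M. norm (q x) \<le> K" "0 \<le> K"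
  shows "L2_norm M (\<lambda>x. q x * f x) \<le> K * L2_norm M f"
proof -
  have "(LINT x|M. (norm (q x * f x))\<^sup>2) \<le> (LINT x|M. K\<^sup>2 * (norm (f x))\<^sup>2)"
  proof (rule integral_mono_AE)
    show "integrable M (\<lambda>x. (norm (q x * f x))\<^sup>2)"
      using L2_bounded_mult[OF assms(1-3)] by (simp add: L2_def)
    show "integrable M (\<lambda>x. K\<^sup>2 * (norm (f x))\<^sup>2)"
      using assms by (auto simp: L2_def)
    show "AE x in M. (norm (q x * f x))\<^sup>2 \<le> K\<^sup>2 * (norm (f x))\<^sup>2"
      using assms(3) by eventually_elim (auto simp: norm_mult power_mult_distrib intro!: mult_right_mono power_mono)
  qed
  then have "L2_norm M (\<lambda>x. q x * f x) \<le> sqrt (K\<^sup>2 * (LINT x|M. (norm (f x))\<^sup>2))"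
    by (simp add: L2_norm_def)
  then show ?thesis using assms(4) by (simp add: L2_norm_def real_sqrt_mult)
qed

section \<open>Square integrable functions for a finite measure\<close>

context finite_measure
begin

lemma L2_const: "(\<lambda>_. c) \<in> L2 M"
  by (simp add: L2_def)

lemma L2_integrable: "f \<in> L2 M \<Longrightarrow> integrable M f"
  using L2_mult_cnj_integrable[of f M "\<lambda>_. 1"] L2_const by simp

text \<open>Cauchy-Schwarz against the constant 1. It turns the L2 rate of a Cauchy sequence into L1
  bounds on its increments.\<close>

lemma L1_le_L2:
  assumes "f \<in> L2 M"
  shows "(LINT x|M. norm (f x)) \<le> sqrt (measure M (space M)) * L2_norm M f"
proof -
  have [measurable]: "f \<in> borel_measurable M" using assms by (simp add: L2_def)
  let ?n = "\<lambda>x. complex_of_real (norm (f x))"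
  have n: "?n \<in> L2 M" using assms by (auto simp: L2_def)
  have "cmod (L2_inner M ?n (\<lambda>_. 1)) \<le> L2_norm M ?n * L2_norm M (\<lambda>_. 1)"
    by (rule L2.Cauchy_Schwarz[OF n L2_const])
  moreover have "L2_inner M ?n (\<lambda>_. 1) = of_real (LINT x|M. norm (f x))"
    by (simp add: L2_inner_def integral_complex_of_real)
  ultimately show ?thesis by (simp add: L2_norm_def mult.commute)
qed

text \<open>The geometric rate makes the L1 norms of the increments summable, so the increments are
  absolutely summable almost everywhere and the whole sequence converges there, with no passage to a
  subsequence. Fatou's lemma turns the Cauchy rate into a rate of convergence to the limit.\<close>

theorem L2_complete:
  fixes f :: "nat \<Rightarrow> 'a \<Rightarrow> complex"
  assumes f: "\<And>n. f n \<in> L2 M"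
    and cauchy: "\<And>m n. n \<le> m \<Longrightarrow> L2_norm M (\<lambda>x. f m x - f n x) \<le> (1/2) ^ n"
  shows "\<exists>g\<in>L2 M. (\<lambda>n. L2_norm M (\<lambda>x. f n x - g x)) \<longlonglongrightarrow> 0"
proof -
  have meas[measurable]: "f n \<in> borel_measurable M" for n using f by (simp add: L2_def)
  define C where "C = sqrt (measure M (space M))"
  define a where "a n x = norm (f (Suc n) x - f n x)" for n x
  have [measurable]: "a n \<in> borel_measurable M" for n unfolding a_def by measurable
  have nn: "(\<integral>\<^sup>+x. ennreal (a n x) \<partial>M) \<le> ennreal (C * (1/2) ^ n)" for n
  proof -
    have d: "(\<lambda>x. f (Suc n) x - f n x) \<in> L2 M" by (intro L2.diff_mem f)
    have "(LINT x|M. a n x) \<le> C * L2_norm M (\<lambda>x. f (Suc n) x - f n x)"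
      unfolding a_def C_def by (rule L1_le_L2[OF d])
    also have "\<dots> \<le> C * (1/2) ^ n"
      by (intro mult_left_mono cauchy) (auto simp: C_def)
    finally have "(LINT x|M. a n x) \<le> C * (1/2) ^ n" .
    moreover have "(\<integral>\<^sup>+x. ennreal (a n x) \<partial>M) = ennreal (LINT x|M. a n x)"
      using L2_integrable[OF d] by (intro nn_integral_eq_integral) (auto simp: a_def)
    ultimately show ?thesis by (simp add: ennreal_leI)
  qed
  have "(\<integral>\<^sup>+x. (\<Sum>n. ennreal (a n x)) \<partial>M) = (\<Sum>n. \<integral>\<^sup>+x. ennreal (a n x) \<partial>M)"
    by (intro nn_integral_suminf) measurable
  also have "\<dots> \<le> (\<Sum>n. ennreal (C * (1/2) ^ n))"
    by (intro suminf_le nn) auto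
  also have "\<dots> < \<infinity>"
  proof -
    have "summable (\<lambda>n. C * (1/2) ^ n)"
      by (intro summable_mult summable_geometric) simp
    then have "(\<Sum>n. ennreal (C * (1/2) ^ n)) \<noteq> top"
      by (rule ennreal_suminf_neq_top) (simp add: C_def)
    then show ?thesis by (simp add: top.not_eq_extremum)
  qed
  finally have "(\<integral>\<^sup>+x. (\<Sum>n. ennreal (a n x)) \<partial>M) \<noteq> \<infinity>" by simp
  then have "AE x in M. (\<Sum>n. ennreal (a n x)) \<noteq> \<infinity>"
    by (intro nn_integral_PInf_AE) measurable
  then have conv: "AE x in M. convergent (\<lambda>n. f n x)"
  proof eventually_elim
    fix x assume "(\<Sum>n. ennreal (a n x)) \<noteq> \<infinity>"
    then have "summable (\<lambda>n. a n x)"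
      by (intro summable_suminf_not_top) (auto simp: a_def)
    then have "summable (\<lambda>n. f (Suc n) x - f n x)"
      unfolding a_def by (rule summable_norm_cancel)
    then have "convergent (\<lambda>m. \<Sum>n<m. f (Suc n) x - f n x)"
      by (simp add: summable_iff_convergent)
    moreover have "(\<Sum>n<m. f (Suc n) x - f n x) = f m x - f 0 x" for m
      using sum_lessThan_telescope[of "\<lambda>n. f n x" m] .
    ultimately have "convergent (\<lambda>m. f m x - f 0 x)" by simp
    then have "convergent (\<lambda>m. (f m x - f 0 x) + f 0 x)"
      by (intro convergent_add convergent_const)
    then show "convergent (\<lambda>n. f n x)" by simp
  qed
  \<comment> \<open>Where the sequence diverges, \<open>lim\<close> is an unspecified value, but
    only on a null set.\<close>
  define g where "g x = lim (\<lambda>n. f n x)" for x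
  have [measurable]: "g \<in> borel_measurable M"
    unfolding g_def by (rule borel_measurable_lim_metric) measurable
  have bound: "(\<integral>\<^sup>+x. ennreal ((norm (f n x - g x))\<^sup>2) \<partial>M) \<le> ennreal (((1/2) ^ n)\<^sup>2)" for n
  proof -
    have "(\<integral>\<^sup>+x. ennreal ((norm (f n x - g x))\<^sup>2) \<partial>M) =
        (\<integral>\<^sup>+x. liminf (\<lambda>m. ennreal ((norm (f n x - f m x))\<^sup>2)) \<partial>M)"
    proof (rule nn_integral_cong_AE)
      show "AE x in M. ennreal ((norm (f n x - g x))\<^sup>2) = liminf (\<lambda>m. ennreal ((norm (f n x - f m x))\<^sup>2))"
        using conv
      proof eventually_elim
        fix x assume "convergent (\<lambda>n. f n x)"
        then have "(\<lambda>n. f n x) \<longlonglongrightarrow> g x" by (simp add: g_def convergent_LIMSEQ_iff)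
        then have "(\<lambda>m. ennreal ((norm (f n x - f m x))\<^sup>2)) \<longlonglongrightarrow> ennreal ((norm (f n x - g x))\<^sup>2)"
          by (intro tendsto_intros tendsto_ennrealI)
        then show "ennreal ((norm (f n x - g x))\<^sup>2) = liminf (\<lambda>m. ennreal ((norm (f n x - f m x))\<^sup>2))"
          by (intro lim_imp_Liminf[symmetric]) auto
      qed
    qed
    also have "\<dots> \<le> liminf (\<lambda>m. \<integral>\<^sup>+x. ennreal ((norm (f n x - f m x))\<^sup>2) \<partial>M)"
      by (intro nn_integral_liminf) measurable
    also have "\<dots> \<le> ennreal (((1/2) ^ n)\<^sup>2)"
    proof (rule Liminf_le)
      show "\<forall>\<^sub>F m in sequentially. (\<integral>\<^sup>+x. ennreal ((norm (f n x - f m x))\<^sup>2) \<partial>M) \<le> ennreal (((1/2) ^ n)\<^sup>2)"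
        using eventually_ge_at_top[of n]
      proof eventually_elim
        case (elim m)
        have d: "(\<lambda>x. f m x - f n x) \<in> L2 M" by (intro L2.diff_mem f)
        have "(LINT x|M. (norm (f m x - f n x))\<^sup>2) = (L2_norm M (\<lambda>x. f m x - f n x))\<^sup>2"
          by (simp add: L2_norm_def)
        also have "\<dots> \<le> ((1/2) ^ n)\<^sup>2"
          using cauchy[OF elim] L2.nrm_nonneg[OF d] by (intro power_mono)
        finally have "(LINT x|M. (norm (f m x - f n x))\<^sup>2) \<le> ((1/2) ^ n)\<^sup>2" .
        moreover have "(\<integral>\<^sup>+x. ennreal ((norm (f n x - f m x))\<^sup>2) \<partial>M) = ennreal (LINT x|M. (norm (f m x - f n x))\<^sup>2)"
          using d by (subst nn_integral_eq_integral[symmetric]) (auto simp: L2_def norm_minus_commute)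
        ultimately show ?case by (simp add: ennreal_leI)
      qed
    qed simp
    finally show ?thesis .
  qed
  have d: "(\<lambda>x. f n x - g x) \<in> L2 M" for n
  proof -
    have "integrable M (\<lambda>x. (norm (f n x - g x))\<^sup>2)"
      using le_less_trans[OF bound[of n] ennreal_less_top] by (intro integrableI_nonneg) auto
    then show ?thesis by (simp add: L2_def)
  qed
  have le: "L2_norm M (\<lambda>x. f n x - g x) \<le> (1/2) ^ n" for n
  proof -
    have "ennreal (LINT x|M. (norm (f n x - g x))\<^sup>2) \<le> ennreal (((1/2) ^ n)\<^sup>2)"
      using bound[of n] d[of n] by (subst (asm) nn_integral_eq_integral) (auto simp: L2_def)
    then have "(LINT x|M. (norm (f n x - g x))\<^sup>2) \<le> ((1/2) ^ n)\<^sup>2"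
      by (simp add: ennreal_le_iff)
    then have "L2_norm M (\<lambda>x. f n x - g x) \<le> sqrt (((1/2) ^ n)\<^sup>2)"
      unfolding L2_norm_def by (rule real_sqrt_le_mono)
    then show ?thesis by simp
  qed
  have "(\<lambda>n. L2_norm M (\<lambda>x. f n x - g x)) \<longlonglongrightarrow> 0"
  proof (rule tendsto_sandwich[OF _ _ tendsto_const])
    show "(\<lambda>n. (1/2::real) ^ n) \<longlonglongrightarrow> 0" by (rule LIMSEQ_power_zero) simp
  qed (auto simp: le L2.nrm_nonneg[OF d])
  \<comment> \<open>\<open>g\<close> is \<open>f 0\<close> minus the error \<open>f 0 - g\<close>,
    both square integrable.\<close>
  moreover have "g \<in> L2 M"
    using L2.diff_mem[OF f d, of 0 0] by simp
  ultimately show ?thesis by blast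
qed

end

section \<open>Weak derivatives\<close>

text \<open>Difference quotients of \<open>h\<close> have integral zero by translation invariance of
  Lebesgue measure. The bounded support provides an integrable majorant, so this passes to their
  limit, the directional derivative.\<close>

lemma lborel_integral_frechet_derivative_eq_0:
  fixes h :: "'a::euclidean_space \<Rightarrow> complex"
  assumes h: "Ck_on 1 UNIV h" and supp: "bounded {x. h x \<noteq> 0}"
  shows "(LINT x|lborel. frechet_derivative h (at x) v) = 0"
proof -
  let ?d = "\<lambda>x. frechet_derivative h (at x) v"
  have der: "(h has_derivative frechet_derivative h (at x)) (at x)" for x
    using Ck_on_SucE(1)[of 0 h] h by simp
  have cd: "continuous_on UNIV ?d" using Ck_on_SucE(2)[of 0 h v] h by simp
  have ch: "continuous_on UNIV h" using Ck_on_Suc_imp[of 0 h] h by simp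
  have lin: "linear (frechet_derivative h (at x))" for x
    using der has_derivative_linear by blast
  obtain R where R: "\<And>x. h x \<noteq> 0 \<Longrightarrow> norm x \<le> R"
    using supp unfolding bounded_iff by blast
  \<comment> \<open>If norm x > |R| + norm v, then \<open>h\<close> vanishes at \<open>x\<close> and
    at \<open>x + t v\<close> for 0 <= t <= 1. For all other \<open>x\<close> these points stay in
    the ball of radius |R| + 2 norm v, hence in \<open>S\<close>, where the derivative is bounded.
    \<open>R\<close> may be negative when \<open>h\<close> is zero, hence the absolute
    value.\<close>
  define S where "S = cball (0::'a) (\<bar>R\<bar> + 2 * norm v + 1)"
  have hS: "h x = 0" if "norm x > \<bar>R\<bar>" for x using R[of x] that by force
  obtain K where K: "\<And>x. x \<in> S \<Longrightarrow> norm (?d x) \<le> K"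
  proof -
    have "bounded (?d ` S)"
      by (intro compact_imp_bounded compact_continuous_image continuous_on_subset[OF cd]) (auto simp: S_def)
    then show ?thesis using that unfolding bounded_iff by blast
  qed
  have "0 \<in> S" by (simp add: S_def)
  then have K0: "0 \<le> K" using K[of 0] norm_ge_zero[of "?d 0"] by linarith
  define t where "t n = 1 / (real n + 1)" for n
  have t: "0 < t n" "t n \<le> 1" for n by (auto simp: t_def)
  have t0: "t \<longlonglongrightarrow> 0" unfolding t_def by real_asymp
  define q where "q n x = (h (x + t n *\<^sub>R v) - h x) /\<^sub>R t n" for n x
  have hint: "integrable lborel h"
  proof -
    have "integrable lborel (\<lambda>x. indicator (cball 0 \<bar>R\<bar>) x *\<^sub>R h x)"
      by (rule borel_integrable_compact) (auto intro: continuous_on_subset[OF ch])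
    also have "(\<lambda>x. indicator (cball 0 \<bar>R\<bar>) x *\<^sub>R h x) = h"
      using hS by (auto simp: fun_eq_iff indicator_def)
    finally show ?thesis .
  qed
  have hint': "integrable lborel (\<lambda>x. h (x + w))" "(LINT x|lborel. h (x + w)) = (LINT x|lborel. h x)" for w
  proof -
    have meas: "h \<in> borel_measurable borel"
      using ch by (rule borel_measurable_continuous_onI)
    have "(\<lambda>x. x + w) = (+) w" by (auto simp: add.commute)
    then have distr: "distr lborel borel (\<lambda>x. x + w) = lborel"
      using lborel_distr_plus[of w] by simp
    then have "integrable (distr lborel borel (\<lambda>x. x + w)) h"
      using hint by simp
    then show "integrable lborel (\<lambda>x. h (x + w))"
      using meas by (subst (asm) integrable_distr_eq) auto
    have "(LINT x|distr lborel borel (\<lambda>x. x + w). h x) = (LINT x|lborel. h (x + w))"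
      using meas by (subst integral_distr) auto
    then show "(LINT x|lborel. h (x + w)) = (LINT x|lborel. h x)"
      by (simp add: distr)
  qed
  have q0: "(LINT x|lborel. q n x) = 0" for n
    unfolding q_def using hint hint' by simp
  have line: "((\<lambda>s. h (x + s *\<^sub>R v)) has_vector_derivative ?d (x + s *\<^sub>R v)) (at s)" for x s
  proof -
    have "((\<lambda>s. x + s *\<^sub>R v) has_derivative (\<lambda>s. s *\<^sub>R v)) (at s)"
      by (auto intro!: derivative_eq_intros)
    from has_derivative_compose[OF this der]
    show ?thesis
      unfolding has_vector_derivative_def by (simp add: linear_cmul[OF lin])
  qed
  have "(\<lambda>n. LINT x|lborel. q n x) \<longlonglongrightarrow> (LINT x|lborel. ?d x)"
  proof (rule integral_dominated_convergence[where w = "\<lambda>x. K * indicator S x"])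
    show "?d \<in> borel_measurable lborel"
      using borel_measurable_continuous_onI[OF cd] by simp
    show "q n \<in> borel_measurable lborel" for n
      unfolding q_def using hint hint' by (intro borel_measurable_integrable) auto
    show "integrable lborel (\<lambda>x. K * indicator S x)"
      by (intro integrable_mult_right integrable_real_indicator)
        (use emeasure_lborel_cball_finite in \<open>auto simp: S_def\<close>)
    show "AE x in lborel. (\<lambda>n. q n x) \<longlonglongrightarrow> ?d x"
    proof (intro AE_I2)
      fix x
      have "((\<lambda>s. (h (x + s *\<^sub>R v) - h x) /\<^sub>R s) \<longlongrightarrow> ?d x) (at 0)"
      proof (rule LIM_zero_cancel, rule tendsto_norm_zero_cancel)
        have "((\<lambda>s. norm (h (x + s *\<^sub>R v) - h x - s *\<^sub>R ?d x) / norm s) \<longlongrightarrow> 0) (at 0)"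
          using line[of x 0] by (simp add: has_vector_derivative_def has_derivative_at)
        then show "((\<lambda>s. norm ((h (x + s *\<^sub>R v) - h x) /\<^sub>R s - ?d x)) \<longlongrightarrow> 0) (at 0)"
        proof (rule Lim_transform_eventually)
          have "norm (h (x + s *\<^sub>R v) - h x - s *\<^sub>R ?d x) / norm s = norm ((h (x + s *\<^sub>R v) - h x) /\<^sub>R s - ?d x)"
            if "s \<noteq> 0" for s
          proof -
            have "(h (x + s *\<^sub>R v) - h x) /\<^sub>R s - ?d x = (h (x + s *\<^sub>R v) - h x - s *\<^sub>R ?d x) /\<^sub>R s"
              using that by (simp add: scaleR_diff_right)
            then show ?thesis by (simp add: divide_inverse mult.commute)
          qed
          then show "\<forall>\<^sub>F s in at 0. norm (h (x + s *\<^sub>R v) - h x - s *\<^sub>R ?d x) / norm s =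
              norm ((h (x + s *\<^sub>R v) - h x) /\<^sub>R s - ?d x)"
            by (auto simp: eventually_at_filter)
        qed
      qed
      moreover have "filterlim t (at 0) sequentially"
        using t0 t(1) by (auto simp: filterlim_at less_imp_neq[symmetric] eventually_sequentially)
      ultimately show "(\<lambda>n. q n x) \<longlonglongrightarrow> ?d x"
        unfolding q_def by (rule filterlim_compose)
    qed
    show "AE x in lborel. norm (q n x) \<le> K * indicator S x" for n
    proof (intro AE_I2)
      fix x
      show "norm (q n x) \<le> K * indicator S x"
      proof (cases "norm x \<le> \<bar>R\<bar> + norm v")
        case False
        have "norm (x + t n *\<^sub>R v) \<ge> norm x - norm v"
          using norm_diff_ineq[of x "t n *\<^sub>R v"] t[of n] mult_right_mono[of "t n" 1 "norm v"] by simp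
        then have "h (x + t n *\<^sub>R v) = 0" using False by (intro hS) linarith
        moreover have "h x = 0" using False norm_ge_zero[of v] by (intro hS) linarith
        ultimately show ?thesis using K0 by (simp add: q_def)
      next
        case True
        have inS: "x + s *\<^sub>R v \<in> S" if "0 \<le> s" "s \<le> t n" for s
        proof -
          have "norm (x + s *\<^sub>R v) \<le> norm x + s * norm v"
            using norm_triangle_ineq[of x "s *\<^sub>R v"] that by simp
          moreover have "s * norm v \<le> norm v"
            using that t(2)[of n] by (intro mult_left_le_one_le) auto
          ultimately show ?thesis using True by (simp add: S_def)
        qed
        have "norm (h (x + t n *\<^sub>R v) - h (x + 0 *\<^sub>R v)) \<le> K * norm (t n - 0)"
        proof (rule differentiable_bound[where S = "{0..t n}" and f = "\<lambda>s. h (x + s *\<^sub>R v)"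
              and f' = "\<lambda>s r. r *\<^sub>R ?d (x + s *\<^sub>R v)"])
          fix s assume "s \<in> {0..t n}"
          then show "onorm (\<lambda>r. r *\<^sub>R ?d (x + s *\<^sub>R v)) \<le> K"
            using K[OF inS[of s]] by (intro onorm_le) (simp add: mult.commute[of K] mult_left_mono)
          show "((\<lambda>s. h (x + s *\<^sub>R v)) has_derivative (\<lambda>r. r *\<^sub>R ?d (x + s *\<^sub>R v))) (at s within {0..t n})"
            using line[of x s] unfolding has_vector_derivative_def by (rule has_derivative_at_withinI)
        qed (use t[of n] in \<open>auto intro: less_imp_le\<close>)
        then have "norm (q n x) \<le> K"
          using t[of n] by (simp add: q_def divide_inverse[symmetric] mult.commute[of "inverse _"] pos_divide_le_eq)
        then show ?thesis using inS[of 0] t[of n] by simp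
      qed
    qed
  qed
  then show ?thesis by (simp add: q0 LIMSEQ_const_iff)
qed

section \<open>Weak derivatives on a bounded open set\<close>

locale bounded_domain =
  fixes D :: "'a::euclidean_space set"
  assumes open_D: "open D" and bounded_D: "bounded D"
begin

abbreviation M where "M \<equiv> lebesgue_on D"

lemma sets_D [simp]: "D \<in> sets lebesgue"
  using open_D by auto

sublocale finite_measure M
  using bounded_D by (intro finite_measure_lebesgue_on bounded_set_imp_lmeasurable) auto

lemma continuous_L2:
  assumes "continuous_on UNIV h"
  shows "h \<in> L2 M"
proof -
  have [measurable]: "h \<in> borel_measurable M"
    using assms by (intro continuous_imp_measurable_on_sets_lebesgue) (auto intro: continuous_on_subset)
  have "bounded (h ` closure D)"
    using bounded_D by (intro compact_imp_bounded compact_continuous_image continuous_on_subset[OF assms]) auto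
  then obtain K where K: "\<And>x. x \<in> closure D \<Longrightarrow> norm (h x) \<le> K"
    unfolding bounded_iff by blast
  have "AE x in M. norm (h x) \<le> K"
    using closure_subset by (intro AE_I2 K) (auto simp: space_restrict_space)
  from L2_bounded_mult[OF L2_const[of 1] _ this] show ?thesis by simp
qed

lemma test_function_L2:
  assumes "\<phi> \<in> test_functions D"
  shows "\<phi> \<in> L2 M" "(\<lambda>x. cnj (\<phi> x)) \<in> L2 M"
    "(\<lambda>x. frechet_derivative \<phi> (at x) v) \<in> L2 M" "(\<lambda>x. cnj (frechet_derivative \<phi> (at x) v)) \<in> L2 M"
proof -
  have "Ck_on (Suc 0) UNIV \<phi>" using assms by (auto simp: test_functions_def smooth_def)
  then have "continuous_on UNIV \<phi>" "continuous_on UNIV (\<lambda>x. frechet_derivative \<phi> (at x) v)"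
    using Ck_on_Suc_imp[of 0 \<phi>] by auto
  then show "\<phi> \<in> L2 M" "(\<lambda>x. cnj (\<phi> x)) \<in> L2 M"
    "(\<lambda>x. frechet_derivative \<phi> (at x) v) \<in> L2 M" "(\<lambda>x. cnj (frechet_derivative \<phi> (at x) v)) \<in> L2 M"
    by (auto intro!: continuous_L2 continuous_on_cnj)
qed

text \<open>Conjugating the test function turns the bilinear pairing of the definition into the
  sesquilinear L2 product, so linearity and Cauchy-Schwarz apply.\<close>

lemma is_weak_partial_iff:
  "is_weak_partial D i u g \<longleftrightarrow> (\<forall>\<phi>\<in>test_functions D.
     L2_inner M u (\<lambda>x. cnj (frechet_derivative \<phi> (at x) i)) = - L2_inner M g (\<lambda>x. cnj (\<phi> x)))"
  by (simp add: is_weak_partial_def L2_inner_def)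

text \<open>Integration by parts: \<open>?d\<close> is the derivative of the product of the two test
  functions, which has bounded support, so its integral over the whole space is zero.\<close>

lemma test_function_is_weak_partial:
  assumes \<phi>: "\<phi> \<in> test_functions D"
  shows "is_weak_partial D i \<phi> (\<lambda>x. frechet_derivative \<phi> (at x) i)"
  unfolding is_weak_partial_def
proof
  fix \<psi> assume \<psi>: "\<psi> \<in> test_functions D"
  have C: "Ck_on (Suc 0) UNIV \<phi>" "Ck_on (Suc 0) UNIV \<psi>"
    using \<phi> \<psi> by (auto simp: test_functions_def smooth_def)
  let ?h = "\<lambda>x. \<phi> x * \<psi> x"
  let ?d = "\<lambda>x. \<phi> x * frechet_derivative \<psi> (at x) i + frechet_derivative \<phi> (at x) i * \<psi> x"
  have Ch: "Ck_on (Suc 0) UNIV ?h" using C by (rule Ck_on_mult)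
  have "frechet_derivative ?h (at x) =
      (\<lambda>v. \<phi> x * frechet_derivative \<psi> (at x) v + frechet_derivative \<phi> (at x) v * \<psi> x)" for x
    by (rule frechet_derivative_at[symmetric])
      (rule has_derivative_mult[OF Ck_on_SucE(1)[OF C(1)] Ck_on_SucE(1)[OF C(2)]])
  then have d: "(\<lambda>x. frechet_derivative ?h (at x) i) = ?d" by (simp add: fun_eq_iff)
  have cd: "continuous_on UNIV ?d"
    using Ck_on_SucE(2)[OF Ch, of i] unfolding d by simp
  have "bounded D" by (rule bounded_D)
  \<comment> \<open>A point off \<open>D\<close> lies in the open complement of the closed support
    of \<open>\<psi>\<close>, so the derivative of \<open>\<psi>\<close> vanishes there too. Hence
    the integrals over \<open>D\<close> and over the whole space agree.\<close>
  moreover have zero: "\<psi> x = 0 \<and> ?d x = 0" if "x \<notin> D" for x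
  proof -
    let ?S = "closure {x. \<psi> x \<noteq> 0}"
    have xS: "x \<notin> ?S" using that \<psi> by (auto simp: test_functions_def)
    have *: "\<psi> y = 0" if "y \<in> - ?S" for y using that closure_subset[of "{x. \<psi> x \<noteq> 0}"] by auto
    have "((\<lambda>_. 0::complex) has_derivative (\<lambda>_. 0)) (at x)" by simp
    then have "(\<psi> has_derivative (\<lambda>_. 0)) (at x)"
    proof (rule has_derivative_transform_within_open)
      show "open (- ?S)" by auto
      show "x \<in> - ?S" using xS by blast
      show "0 = \<psi> y" if "y \<in> - ?S" for y using *[OF that] ..
    qed
    then have "frechet_derivative \<psi> (at x) = (\<lambda>_. 0)" by (rule frechet_derivative_at[symmetric])
    moreover have "\<psi> x = 0" by (rule *) (use xS in blast)
    ultimately show ?thesis by simp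
  qed
  ultimately have "bounded {x. ?h x \<noteq> 0}"
    using bounded_subset[of D "{x. ?h x \<noteq> 0}"] by force
  then have "(LINT x|lborel. ?d x) = 0"
    using lborel_integral_frechet_derivative_eq_0[of ?h i] Ch d by simp
  also have "(LINT x|lborel. ?d x) = (LINT x|lebesgue. ?d x)"
    using borel_measurable_continuous_onI[OF cd] by (intro integral_completion[symmetric]) simp
  also have "\<dots> = (LINT x|lebesgue. indicator D x *\<^sub>R ?d x)"
  proof (rule Bochner_Integration.integral_cong[OF refl])
    fix x show "?d x = indicator D x *\<^sub>R ?d x"
    proof (cases "x \<in> D")
      case False
      then have "?d x = 0" using zero by blast
      then show ?thesis by (simp only: scaleR_zero_right)
    qed simp
  qed
  also have "\<dots> = (LINT x|M. ?d x)"
    by (rule integral_restrict_space[symmetric]) simp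
  also have "\<dots> = (LINT x|M. \<phi> x * frechet_derivative \<psi> (at x) i) + (LINT x|M. frechet_derivative \<phi> (at x) i * \<psi> x)"
    using L2_mult_cnj_integrable[OF test_function_L2(1)[OF \<phi>] test_function_L2(4)[OF \<psi>, of i]]
      L2_mult_cnj_integrable[OF test_function_L2(3)[OF \<phi>, of i] test_function_L2(2)[OF \<psi>]]
    by (intro Bochner_Integration.integral_add) simp_all
  finally show "(LINT x|M. \<phi> x * frechet_derivative \<psi> (at x) i) = - (LINT x|M. frechet_derivative \<phi> (at x) i * \<psi> x)"
    by (simp add: eq_neg_iff_add_eq_0)
qed

text \<open>The difference of two candidates annihilates all test functions, and on a bounded set it
  is integrable, as the fundamental lemma requires.\<close>

lemma weak_partial_unique:
  assumes "g \<in> L2 M" "g' \<in> L2 M" "is_weak_partial D i u g" "is_weak_partial D i u g'"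
  shows "AE x in M. g x = g' x"
proof -
  let ?d = "\<lambda>x. g x - g' x"
  have d: "?d \<in> L2 M" using assms by (intro L2.diff_mem)
  have "(LINT x|M. ?d x * \<phi> x) = 0" if "\<phi> \<in> test_functions D" for \<phi>
  proof -
    have "L2_inner M ?d (\<lambda>x. cnj (\<phi> x)) = 0"
      using assms that test_function_L2[OF that] by (simp add: L2.ip_diff is_weak_partial_iff)
    then show ?thesis by (simp add: L2_inner_def)
  qed
  from fundamental_lemma_of_calculus_of_variations[OF open_D L2_integrable[OF d] this]
  show ?thesis by simp
qed

text \<open>One existing weak derivative gives the \<open>SOME\<close> a meaning; uniqueness then
  lets any candidate stand in for the chosen one almost everywhere.\<close>

lemma weak_partial_spec:
  assumes "g \<in> L2 M" "is_weak_partial D i u g"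
  shows "weak_partial D i u \<in> L2 M" "is_weak_partial D i u (weak_partial D i u)"
    "AE x in M. weak_partial D i u x = g x"
proof -
  show *: "weak_partial D i u \<in> L2 M" "is_weak_partial D i u (weak_partial D i u)"
    unfolding weak_partial_def
    using someI[of "\<lambda>g. g \<in> L2 M \<and> is_weak_partial D i u g" g] assms by auto
  show "AE x in M. weak_partial D i u x = g x"
    using weak_partial_unique[OF *(1) assms(1) *(2) assms(2)] .
qed

lemma is_weak_partial_cong_AE:
  assumes "u \<in> L2 M" "v \<in> L2 M" "AE x in M. u x = v x"
  shows "is_weak_partial D i u = is_weak_partial D i v"
proof -
  have "L2_inner M u (\<lambda>x. cnj (frechet_derivative \<phi> (at x) i)) = L2_inner M v (\<lambda>x. cnj (frechet_derivative \<phi> (at x) i))"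
    if "\<phi> \<in> test_functions D" for \<phi>
    using assms test_function_L2(4)[OF that, of i] by (intro L2_inner_cong_AE) (auto simp: L2_def)
  then show ?thesis by (simp add: is_weak_partial_iff fun_eq_iff)
qed

lemma is_weak_partial_lincomb:
  assumes "u \<in> L2 M" "v \<in> L2 M" "g \<in> L2 M" "h \<in> L2 M" "is_weak_partial D i u g" "is_weak_partial D i v h"
  shows "is_weak_partial D i (\<lambda>x. a * u x + b * v x) (\<lambda>x. a * g x + b * h x)"
  unfolding is_weak_partial_iff
proof
  fix \<phi> assume \<phi>: "\<phi> \<in> test_functions D"
  have [simp]: "(\<lambda>x. c * f x) \<in> L2 M" if "f \<in> {u, v, g, h}" for f c
    using that assms L2_scale by blast
  show "L2_inner M (\<lambda>x. a * u x + b * v x) (\<lambda>x. cnj (frechet_derivative \<phi> (at x) i)) =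
      - L2_inner M (\<lambda>x. a * g x + b * h x) (\<lambda>x. cnj (\<phi> x))"
    using assms \<phi> test_function_L2[OF \<phi>]
    by (simp add: L2.ip_add L2.ip_scale is_weak_partial_iff)
qed

lemma L2_inner_tendsto:
  assumes "\<And>n. f n \<in> L2 M" "g \<in> L2 M" "w \<in> L2 M" "(\<lambda>n. L2_norm M (\<lambda>x. f n x - g x)) \<longlonglongrightarrow> 0"
  shows "(\<lambda>n. L2_inner M (f n) w) \<longlonglongrightarrow> L2_inner M g w"
proof (rule LIM_zero_cancel, rule Lim_null_comparison)
  show "(\<lambda>n. L2_norm M (\<lambda>x. f n x - g x) * L2_norm M w) \<longlonglongrightarrow> 0"
    using tendsto_mult_right[OF assms(4), of "L2_norm M w"] by simp
  show "\<forall>\<^sub>F n in sequentially. norm (L2_inner M (f n) w - L2_inner M g w) \<le> L2_norm M (\<lambda>x. f n x - g x) * L2_norm M w"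
    using L2.Cauchy_Schwarz[OF L2.diff_mem[OF assms(1,2)] assms(3)] assms(1-3)
    by (simp add: L2.ip_diff)
qed

text \<open>Weak differentiation is a closed operator: both sides of its defining identity are L2
  products with a fixed function, hence continuous. Completeness of the Sobolev spaces rests on
  this.\<close>

lemma is_weak_partial_limit:
  assumes "\<And>n. f n \<in> L2 M" "\<And>n. f' n \<in> L2 M" "g \<in> L2 M" "g' \<in> L2 M"
    and "\<And>n. is_weak_partial D i (f n) (f' n)"
    and "(\<lambda>n. L2_norm M (\<lambda>x. f n x - g x)) \<longlonglongrightarrow> 0" "(\<lambda>n. L2_norm M (\<lambda>x. f' n x - g' x)) \<longlonglongrightarrow> 0"
  shows "is_weak_partial D i g g'"
  unfolding is_weak_partial_iff
proof
  fix \<phi> assume \<phi>: "\<phi> \<in> test_functions D"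
  note T = test_function_L2[OF \<phi>]
  have "(\<lambda>n. L2_inner M (f n) (\<lambda>x. cnj (frechet_derivative \<phi> (at x) i))) \<longlonglongrightarrow>
      L2_inner M g (\<lambda>x. cnj (frechet_derivative \<phi> (at x) i))"
    by (intro L2_inner_tendsto assms T)
  moreover have eq: "(\<lambda>n. L2_inner M (f n) (\<lambda>x. cnj (frechet_derivative \<phi> (at x) i))) =
      (\<lambda>n. - L2_inner M (f' n) (\<lambda>x. cnj (\<phi> x)))"
    using assms(5) \<phi> unfolding is_weak_partial_iff by blast
  moreover have "(\<lambda>n. - L2_inner M (f' n) (\<lambda>x. cnj (\<phi> x))) \<longlonglongrightarrow> - L2_inner M g' (\<lambda>x. cnj (\<phi> x))"
    by (intro tendsto_minus L2_inner_tendsto assms T)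
  ultimately show "L2_inner M g (\<lambda>x. cnj (frechet_derivative \<phi> (at x) i)) = - L2_inner M g' (\<lambda>x. cnj (\<phi> x))"
    using LIMSEQ_unique by metis
qed


text \<open>The head of the list is differentiated last, so the intermediate derivatives of a jet
  belong to the suffixes of its list.\<close>

primrec weak_jet :: "'a list \<Rightarrow> ('a \<Rightarrow> complex) \<Rightarrow> 'a \<Rightarrow> complex" where
  "weak_jet [] u = u"
| "weak_jet (i # l) u = weak_partial D i (weak_jet l u)"

text \<open>Existence is demanded at every stage, so that no \<open>SOME\<close> inside the jet is
  arbitrary.\<close>

primrec weak_diff :: "'a list \<Rightarrow> ('a \<Rightarrow> complex) \<Rightarrow> bool" where
  "weak_diff [] u \<longleftrightarrow> u \<in> L2 M"
| "weak_diff (i # l) u \<longleftrightarrow> weak_diff l u \<and> (\<exists>g\<in>L2 M. is_weak_partial D i (weak_jet l u) g)"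

lemma weak_diff_jet_L2: "weak_diff l u \<Longrightarrow> weak_jet l u \<in> L2 M"
  by (cases l) (auto intro: weak_partial_spec(1))

text \<open>Weak derivatives do not see null sets, so a chosen jet may be replaced by an almost
  everywhere equal function before the next derivative is taken. This is the inductive step of both
  results on jets below.\<close>

lemma weak_jet_ConsI:
  assumes l: "weak_diff l u" "AE x in M. weak_jet l u x = v x"
    and v: "v \<in> L2 M" "g \<in> L2 M" "is_weak_partial D i v g"
  shows "weak_diff (i # l) u \<and> (AE x in M. weak_jet (i # l) u x = g x)"
proof -
  have "is_weak_partial D i (weak_jet l u) g"
    using is_weak_partial_cong_AE[OF weak_diff_jet_L2[OF l(1)] v(1) l(2)] v(3) by simp
  then show ?thesis
    using l(1) v(2) weak_partial_spec(3)[OF v(2)] by auto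
qed

lemma weak_jet_lincomb:
  assumes "weak_diff l u" "weak_diff l v"
  shows "weak_diff l (\<lambda>x. a * u x + b * v x) \<and>
    (AE x in M. weak_jet l (\<lambda>x. a * u x + b * v x) x = a * weak_jet l u x + b * weak_jet l v x)"
  using assms
proof (induction l)
  case Nil
  then show ?case by (auto intro!: L2_add L2_scale)
next
  case (Cons i l)
  have u: "weak_diff l u" "weak_diff l v" using Cons.prems by auto
  have g: "weak_jet (i # l) u \<in> L2 M" "is_weak_partial D i (weak_jet l u) (weak_jet (i # l) u)"
    using Cons.prems(1) weak_partial_spec by auto
  have h: "weak_jet (i # l) v \<in> L2 M" "is_weak_partial D i (weak_jet l v) (weak_jet (i # l) v)"
    using Cons.prems(2) weak_partial_spec by auto
  show ?case
  proof (rule weak_jet_ConsI)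
    show "is_weak_partial D i (\<lambda>x. a * weak_jet l u x + b * weak_jet l v x)
        (\<lambda>x. a * weak_jet (i # l) u x + b * weak_jet (i # l) v x)"
      by (intro is_weak_partial_lincomb weak_diff_jet_L2[OF u(1)] weak_diff_jet_L2[OF u(2)] g h)
  qed (use Cons.IH[OF u] u g h in \<open>auto simp del: weak_jet.simps intro!: L2_add L2_scale weak_diff_jet_L2\<close>)
qed

text \<open>\<open>G\<close> lists the L2 limits of all jets along the sequence, with
  \<open>G []\<close> the limit of the functions themselves. Closedness of weak differentiation,
  applied suffix by suffix, identifies \<open>G l\<close> with a jet of \<open>G []\<close>.\<close>

lemma weak_jet_limit:
  assumes "\<And>n. weak_diff l (f n)" "\<And>l'. suffix l' l \<Longrightarrow> G l' \<in> L2 M"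
    "\<And>l'. suffix l' l \<Longrightarrow> (\<lambda>n. L2_norm M (\<lambda>x. weak_jet l' (f n) x - G l' x)) \<longlonglongrightarrow> 0"
  shows "weak_diff l (G []) \<and> (AE x in M. weak_jet l (G []) x = G l x)"
  using assms
proof (induction l)
  case Nil
  then show ?case by auto
next
  case (Cons i l)
  have IH: "weak_diff l (G []) \<and> (AE x in M. weak_jet l (G []) x = G l x)"
    by (rule Cons.IH) (use Cons.prems in \<open>auto simp: suffix_ConsI\<close>)
  show ?case
  proof (rule weak_jet_ConsI)
    show "is_weak_partial D i (G l) (G (i # l))"
    proof (rule is_weak_partial_limit)
      show "is_weak_partial D i (weak_jet l (f n)) (weak_jet (i # l) (f n))" for n
        using Cons.prems(1)[of n] weak_partial_spec by auto
      show "(\<lambda>n. L2_norm M (\<lambda>x. weak_jet l (f n) x - G l x)) \<longlonglongrightarrow> 0"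
        "(\<lambda>n. L2_norm M (\<lambda>x. weak_jet (i # l) (f n) x - G (i # l) x)) \<longlonglongrightarrow> 0"
        "G l \<in> L2 M" "G (i # l) \<in> L2 M"
        using Cons.prems(2,3) by (simp_all add: suffix_ConsI del: weak_jet.simps)
      show "weak_jet l (f n) \<in> L2 M" "weak_jet (i # l) (f n) \<in> L2 M" for n
        using weak_diff_jet_L2[OF Cons.prems(1)[of n]] Cons.prems(1)[of n] weak_diff_jet_L2[of l]
        by (auto simp del: weak_jet.simps)
    qed
  qed (use IH Cons.prems(2) in \<open>auto simp: suffix_ConsI\<close>)
qed

text \<open>The index set treats the first and second order Sobolev spaces at once;
  \<open>I1\<close> and \<open>I2\<close> recover them.\<close>

definition jet_space :: "'a list set \<Rightarrow> ('a \<Rightarrow> complex) set" where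
  "jet_space I = {u. \<forall>l\<in>I. weak_diff l u}"

definition jet_inner :: "'a list set \<Rightarrow> ('a \<Rightarrow> complex) \<Rightarrow> ('a \<Rightarrow> complex) \<Rightarrow> complex" where
  "jet_inner I u v = (\<Sum>l\<in>I. L2_inner M (weak_jet l u) (weak_jet l v))"

lemma jet_space_L2: "u \<in> jet_space I \<Longrightarrow> l \<in> I \<Longrightarrow> weak_jet l u \<in> L2 M"
  by (auto simp: jet_space_def weak_diff_jet_L2)

lemma jet_space_lincomb:
  assumes "u \<in> jet_space I" "v \<in> jet_space I"
  shows "(\<lambda>x. a * u x + b * v x) \<in> jet_space I"
  using assms weak_jet_lincomb by (auto simp: jet_space_def)

lemma jet_inner_lincomb:
  assumes "u \<in> jet_space I" "v \<in> jet_space I" "w \<in> jet_space I"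
  shows "jet_inner I (\<lambda>x. a * u x + b * v x) w = a * jet_inner I u w + b * jet_inner I v w"
  unfolding jet_inner_def sum_distrib_left sum.distrib[symmetric]
proof (rule sum.cong[OF refl])
  fix l assume l: "l \<in> I"
  note L = jet_space_L2[OF assms(1) l] jet_space_L2[OF assms(2) l] jet_space_L2[OF assms(3) l]
  note L' = L2_scale[OF L(1), of a] L2_scale[OF L(2), of b]
  have "L2_inner M (weak_jet l (\<lambda>x. a * u x + b * v x)) (weak_jet l w) =
      L2_inner M (\<lambda>x. a * weak_jet l u x + b * weak_jet l v x) (weak_jet l w)"
  proof (rule L2_inner_cong_AE)
    show "AE x in M. weak_jet l (\<lambda>x. a * u x + b * v x) x = a * weak_jet l u x + b * weak_jet l v x"
      using assms l weak_jet_lincomb by (auto simp: jet_space_def)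
    show "weak_jet l (\<lambda>x. a * u x + b * v x) \<in> L2 M"
      using jet_space_L2[OF jet_space_lincomb[OF assms(1,2)] l] .
  qed (use L L2_add[OF L'] in \<open>auto simp: L2_def\<close>)
  then show "L2_inner M (weak_jet l (\<lambda>x. a * u x + b * v x)) (weak_jet l w) =
      a * L2_inner M (weak_jet l u) (weak_jet l w) + b * L2_inner M (weak_jet l v) (weak_jet l w)"
    using L L' by (simp add: L2.ip_add L2.ip_scale)
qed

lemma semi_inner_jet: "semi_inner (jet_space I) (jet_inner I)"
proof
  show "(\<lambda>x. u x + v x) \<in> jet_space I" if "u \<in> jet_space I" "v \<in> jet_space I" for u v
    using jet_space_lincomb[OF that, of 1 1] by simp
  show "(\<lambda>x. c * u x) \<in> jet_space I" if "u \<in> jet_space I" for u c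
    using jet_space_lincomb[OF that that, of c 0] by simp
  show "jet_inner I (\<lambda>x. u x + v x) w = jet_inner I u w + jet_inner I v w"
    if "u \<in> jet_space I" "v \<in> jet_space I" "w \<in> jet_space I" for u v w
    using jet_inner_lincomb[OF that, of 1 1] by simp
  show "jet_inner I (\<lambda>x. c * u x) w = c * jet_inner I u w"
    if "u \<in> jet_space I" "w \<in> jet_space I" for u w c
    using jet_inner_lincomb[OF that(1) that, of c 0] by simp
  show "jet_inner I v u = cnj (jet_inner I u v)" if "u \<in> jet_space I" "v \<in> jet_space I" for u v
    unfolding jet_inner_def cnj_sum
    by (intro sum.cong refl L2.ip_cnj jet_space_L2[OF that(1)] jet_space_L2[OF that(2)])
  show "0 \<le> Re (jet_inner I u u)" if "u \<in> jet_space I" for u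
    unfolding jet_inner_def Re_sum by (intro sum_nonneg L2.ip_nonneg jet_space_L2[OF that])
qed

definition jet_norm :: "'a list set \<Rightarrow> ('a \<Rightarrow> complex) \<Rightarrow> real" where
  "jet_norm I u = sqrt (Re (jet_inner I u u))"

sublocale jet: semi_inner "jet_space I" "jet_inner I"
  rewrites "semi_inner.nrm (jet_inner I) = jet_norm I"
  for I
  by (rule semi_inner_jet) (simp add: fun_eq_iff jet_norm_def semi_inner.nrm_def[OF semi_inner_jet[of I]])

lemma jet_norm_sq:
  "(jet_norm I u)\<^sup>2 = (\<Sum>l\<in>I. (L2_norm M (weak_jet l u))\<^sup>2)"
proof -
  have "Re (jet_inner I u u) = (\<Sum>l\<in>I. (L2_norm M (weak_jet l u))\<^sup>2)"
    by (simp add: jet_inner_def L2_inner_self L2_norm_def)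
  moreover from this have "0 \<le> Re (jet_inner I u u)" by (simp add: sum_nonneg)
  ultimately show ?thesis by (simp add: jet_norm_def)
qed

lemma jet_norm_mono:
  assumes "J \<subseteq> I" "finite I"
  shows "jet_norm J u \<le> jet_norm I u"
proof (rule power2_le_imp_le)
  show "(jet_norm J u)\<^sup>2 \<le> (jet_norm I u)\<^sup>2"
    unfolding jet_norm_sq by (rule sum_mono2) (use assms in auto)
  have "Re (jet_inner I u u) \<ge> 0"
    by (simp add: jet_inner_def L2_inner_self sum_nonneg)
  then show "0 \<le> jet_norm I u" by (simp add: jet_norm_def)
qed

lemma L2_norm_weak_jet_le:
  assumes "l \<in> I" "finite I"
  shows "L2_norm M (weak_jet l u) \<le> jet_norm I u"
proof -
  have "jet_norm {l} u = L2_norm M (weak_jet l u)"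
    by (simp add: jet_norm_def jet_inner_def L2_inner_self L2_norm_def)
  then show ?thesis using jet_norm_mono[of "{l}" I u] assms by simp
qed

lemma L2_norm_weak_jet_diff:
  assumes "u \<in> jet_space I" "v \<in> jet_space I" "l \<in> I"
  shows "L2_norm M (weak_jet l (\<lambda>x. u x - v x)) = L2_norm M (\<lambda>x. weak_jet l u x - weak_jet l v x)"
proof (rule L2_norm_cong_AE)
  show "weak_jet l (\<lambda>x. u x - v x) \<in> L2 M"
    by (rule jet_space_L2[OF jet.diff_mem[OF assms(1,2)] assms(3)])
  show "AE x in M. weak_jet l (\<lambda>x. u x - v x) x = weak_jet l u x - weak_jet l v x"
    using weak_jet_lincomb[of l u v 1 "-1"] assms by (auto simp: jet_space_def)
  show "(\<lambda>x. weak_jet l u x - weak_jet l v x) \<in> borel_measurable M"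
    using L2.diff_mem[OF jet_space_L2[OF assms(1,3)] jet_space_L2[OF assms(2,3)]] by (simp add: L2_def)
qed

text \<open>Every jet in \<open>I\<close> is Cauchy in L2. Closure of \<open>I\<close> under
  suffixes ensures that the intermediate derivatives converge as well, which is what identifies the
  limits as jets of one function.\<close>

theorem jet_space_complete:
  assumes I: "finite I" "[] \<in> I" "\<And>l l'. l \<in> I \<Longrightarrow> suffix l' l \<Longrightarrow> l' \<in> I"
    and f: "\<And>n. f n \<in> jet_space I"
    and cauchy: "\<And>m n. n \<le> m \<Longrightarrow> jet_norm I (\<lambda>x. f m x - f n x) \<le> (1/2) ^ n"
  shows "\<exists>w\<in>jet_space I. (\<lambda>n. jet_norm I (\<lambda>x. f n x - w x)) \<longlonglongrightarrow> 0"
proof -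
  have "\<exists>g\<in>L2 M. (\<lambda>n. L2_norm M (\<lambda>x. weak_jet l (f n) x - g x)) \<longlonglongrightarrow> 0" if l: "l \<in> I" for l
  proof (rule L2_complete)
    show "L2_norm M (\<lambda>x. weak_jet l (f m) x - weak_jet l (f n) x) \<le> (1/2) ^ n" if "n \<le> m" for m n
      using L2_norm_weak_jet_le[OF l I(1), of "\<lambda>x. f m x - f n x"] cauchy[OF that]
        L2_norm_weak_jet_diff[OF f f l, of m n] by simp
  qed (rule jet_space_L2[OF f l])
  then have "\<forall>l\<in>I. \<exists>g. g \<in> L2 M \<and> (\<lambda>n. L2_norm M (\<lambda>x. weak_jet l (f n) x - g x)) \<longlonglongrightarrow> 0"
    by blast
  from bchoice[OF this] obtain G where G: "\<And>l. l \<in> I \<Longrightarrow> G l \<in> L2 M"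
    "\<And>l. l \<in> I \<Longrightarrow> (\<lambda>n. L2_norm M (\<lambda>x. weak_jet l (f n) x - G l x)) \<longlonglongrightarrow> 0"
    by blast
  have lim: "weak_diff l (G []) \<and> (AE x in M. weak_jet l (G []) x = G l x)" if l: "l \<in> I" for l
    by (rule weak_jet_limit[where f = f]) (use f l G I(3)[OF l] in \<open>auto simp: jet_space_def\<close>)
  then have w: "G [] \<in> jet_space I" by (simp add: jet_space_def)
  have "(\<lambda>n. (jet_norm I (\<lambda>x. f n x - G [] x))\<^sup>2) \<longlonglongrightarrow> 0"
  proof -
    have "L2_norm M (weak_jet l (\<lambda>x. f n x - G [] x)) = L2_norm M (\<lambda>x. weak_jet l (f n) x - G l x)"
      if l: "l \<in> I" for l n
    proof -
      note L = jet_space_L2[OF f l] jet_space_L2[OF w l]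
      have "L2_norm M (\<lambda>x. weak_jet l (f n) x - weak_jet l (G []) x) = L2_norm M (\<lambda>x. weak_jet l (f n) x - G l x)"
        using lim[OF l] L2.diff_mem[OF L(1) L(2)] L2.diff_mem[OF L(1) G(1)[OF l]]
        by (intro L2_norm_cong_AE) (auto simp: L2_def)
      then show ?thesis using L2_norm_weak_jet_diff[OF f w l] by simp
    qed
    then have "(\<lambda>n. (jet_norm I (\<lambda>x. f n x - G [] x))\<^sup>2) =
        (\<lambda>n. \<Sum>l\<in>I. (L2_norm M (\<lambda>x. weak_jet l (f n) x - G l x))\<^sup>2)"
      by (simp add: jet_norm_sq)
    moreover have "\<dots> \<longlonglongrightarrow> (\<Sum>l\<in>I. 0\<^sup>2)"
      by (intro tendsto_sum tendsto_power G(2))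
    ultimately show ?thesis by simp
  qed
  then have "(\<lambda>n. sqrt ((jet_norm I (\<lambda>x. f n x - G [] x))\<^sup>2)) \<longlonglongrightarrow> sqrt 0"
    by (rule tendsto_real_sqrt)
  moreover have "sqrt ((jet_norm I (\<lambda>x. f n x - G [] x))\<^sup>2) = jet_norm I (\<lambda>x. f n x - G [] x)" for n
    using jet.nrm_nonneg[OF jet.diff_mem[OF f w]] by simp
  ultimately show ?thesis using w by auto
qed

end

section \<open>The Sobolev spaces\<close>

lemma test_functions_lincomb:
  assumes "\<phi> \<in> test_functions D" "\<psi> \<in> test_functions D"
  shows "(\<lambda>x. a * \<phi> x + b * \<psi> x) \<in> test_functions D"
proof -
  let ?S = "closure {x. \<phi> x \<noteq> 0} \<union> closure {x. \<psi> x \<noteq> 0}"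
  have S: "compact ?S" "?S \<subseteq> D"
    using assms by (auto simp: test_functions_def intro: compact_Un)
  have "{x. a * \<phi> x + b * \<psi> x \<noteq> 0} \<subseteq> {x. \<phi> x \<noteq> 0} \<union> {x. \<psi> x \<noteq> 0}" by auto
  then have sub: "closure {x. a * \<phi> x + b * \<psi> x \<noteq> 0} \<subseteq> ?S"
    using closure_mono[of "{x. a * \<phi> x + b * \<psi> x \<noteq> 0}" "{x. \<phi> x \<noteq> 0} \<union> {x. \<psi> x \<noteq> 0}"]
    by (simp only: closure_Un)
  moreover have "compact (closure {x. a * \<phi> x + b * \<psi> x \<noteq> 0})"
    using bounded_subset[OF compact_imp_bounded[OF S(1)] sub] by (simp add: compact_eq_bounded_closed)
  moreover have "smooth (\<lambda>x. a * \<phi> x + b * \<psi> x)"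
    using assms by (auto simp: test_functions_def smooth_def intro!: Ck_on_add Ck_on_mult Ck_on_const)
  ultimately show ?thesis using S by (auto simp: test_functions_def)
qed

context bounded_domain
begin

definition I1 :: "'a list set" where
  "I1 = insert [] ((\<lambda>i. [i]) ` Basis)"

definition I2 :: "'a list set" where
  "I2 = I1 \<union> (\<lambda>(i, j). [i, j]) ` (Basis \<times> Basis)"

lemma finite_I2: "finite I2" and I1_subset_I2: "I1 \<subseteq> I2"
  by (auto simp: I1_def I2_def)

lemma suffix_I2:
  assumes "l \<in> I2" "suffix l' l"
  shows "l' \<in> I2"
  using assms by (auto simp: I1_def I2_def suffix_Cons)

lemma H1_eq: "H1 D = jet_space I1"
  by (auto simp: H1_def jet_space_def I1_def)

lemma H2_eq: "H2 D = jet_space I2"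
proof -
  have L2: "weak_partial D i u \<in> L2 M" if "u \<in> H1 D" "i \<in> Basis" for i u
    using that weak_partial_spec(1) by (auto simp: H1_def)
  have "u \<in> jet_space I2 \<longleftrightarrow> u \<in> H1 D \<and> (\<forall>i\<in>Basis. \<forall>j\<in>Basis. weak_diff [i, j] u)" for u
    unfolding H1_eq jet_space_def I2_def by (simp only: mem_Collect_eq ball_Un) (simp del: weak_diff.simps)
  moreover have "u \<in> H2 D \<longleftrightarrow> u \<in> H1 D \<and> (\<forall>i\<in>Basis. \<forall>j\<in>Basis. weak_diff [i, j] u)" for u
  proof -
    have "weak_diff [i, j] u \<longleftrightarrow> (\<exists>g\<in>L2 M. is_weak_partial D i (weak_partial D j u) g)"
      if "u \<in> H1 D" "j \<in> Basis" for i j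
      using that by (auto simp: H1_def)
    then show ?thesis using L2 unfolding H2_def H1_def[of D] by blast
  qed
  ultimately show ?thesis by blast
qed

lemma H1_inner_eq: "H1_inner D = jet_inner I1"
proof (intro ext)
  fix u v
  have "jet_inner I1 u v = L2_inner M u v + (\<Sum>l\<in>(\<lambda>i. [i]) ` Basis. L2_inner M (weak_jet l u) (weak_jet l v))"
    unfolding jet_inner_def I1_def by (subst sum.insert) auto
  also have "\<dots> = H1_inner D u v"
    unfolding H1_inner_def by (subst sum.reindex) (auto simp: inj_on_def)
  finally show "H1_inner D u v = jet_inner I1 u v" by simp
qed

lemma H2_inner_eq: "H2_inner D = jet_inner I2"
proof (intro ext)
  fix u v
  have "jet_inner I2 u v = jet_inner I1 u v +
      (\<Sum>l\<in>(\<lambda>(i, j). [i, j]) ` (Basis \<times> Basis). L2_inner M (weak_jet l u) (weak_jet l v))"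
    unfolding jet_inner_def I2_def by (subst sum.union_disjoint) (auto simp: I1_def)
  also have "\<dots> = jet_inner I1 u v + (\<Sum>p\<in>Basis \<times> Basis.
      L2_inner M (weak_partial D (fst p) (weak_partial D (snd p) u)) (weak_partial D (fst p) (weak_partial D (snd p) v)))"
    by (subst sum.reindex) (auto simp: inj_on_def case_prod_beta)
  also have "\<dots> = H2_inner D u v"
    unfolding H2_inner_def H1_inner_eq sum.cartesian_product by (simp add: case_prod_beta)
  finally show "H2_inner D u v = jet_inner I2 u v" by simp
qed

lemma H1_norm_eq: "H1_norm D = jet_norm I1"
  by (simp add: fun_eq_iff H1_norm_def jet_norm_def H1_inner_eq)

lemma H2_norm_eq: "H2_norm D = jet_norm I2"
  by (simp add: fun_eq_iff H2_norm_def jet_norm_def H2_inner_eq)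

lemma test_function_H1: "\<phi> \<in> test_functions D \<Longrightarrow> \<phi> \<in> jet_space I1"
  unfolding H1_eq[symmetric] H1_def
  using test_function_L2(1,3) test_function_is_weak_partial by blast

lemma H10_add:
  assumes "u \<in> H10 D" "v \<in> H10 D"
  shows "(\<lambda>x. u x + v x) \<in> H10 D"
proof -
  have uv: "u \<in> jet_space I1" "v \<in> jet_space I1" using assms by (auto simp: H10_def H1_eq)
  have "\<exists>\<phi>\<in>test_functions D. jet_norm I1 (\<lambda>x. u x + v x - \<phi> x) < \<epsilon>" if "\<epsilon> > 0" for \<epsilon>
  proof -
    have "\<epsilon>/2 > 0" using that by simp
    then obtain \<phi> \<psi> where t: "\<phi> \<in> test_functions D" "\<psi> \<in> test_functions D"
        "jet_norm I1 (\<lambda>x. u x - \<phi> x) < \<epsilon>/2" "jet_norm I1 (\<lambda>x. v x - \<psi> x) < \<epsilon>/2"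
      using assms unfolding H10_def H1_norm_eq by blast
    have "jet_norm I1 (\<lambda>x. (u x - \<phi> x) + (v x - \<psi> x)) \<le> jet_norm I1 (\<lambda>x. u x - \<phi> x) + jet_norm I1 (\<lambda>x. v x - \<psi> x)"
      using uv test_function_H1[OF t(1)] test_function_H1[OF t(2)]
      by (intro jet.nrm_triangle jet.diff_mem)
    moreover have "(\<lambda>x. (u x - \<phi> x) + (v x - \<psi> x)) = (\<lambda>x. u x + v x - (1 * \<phi> x + 1 * \<psi> x))"
      by (simp add: algebra_simps)
    ultimately show ?thesis
      using t(3,4) by (intro bexI[OF _ test_functions_lincomb[OF t(1,2), of 1 1]]) simp
  qed
  then show ?thesis using jet.add_mem[OF uv] by (simp add: H10_def H1_eq H1_norm_eq)
qed

lemma H10_scale: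
  assumes "u \<in> H10 D"
  shows "(\<lambda>x. c * u x) \<in> H10 D"
proof -
  have u: "u \<in> jet_space I1" using assms by (auto simp: H10_def H1_eq)
  have "\<exists>\<phi>\<in>test_functions D. jet_norm I1 (\<lambda>x. c * u x - \<phi> x) < \<epsilon>" if "\<epsilon> > 0" for \<epsilon>
  proof -
    \<comment> \<open>The summand 1 keeps the quotient meaningful for \<open>c = 0\<close>.\<close>
    have "\<epsilon> / (cmod c + 1) > 0" using that by (simp add: add_nonneg_pos)
    then obtain \<phi> where t: "\<phi> \<in> test_functions D" "jet_norm I1 (\<lambda>x. u x - \<phi> x) < \<epsilon> / (cmod c + 1)"
      using assms unfolding H10_def H1_norm_eq by blast
    have d: "(\<lambda>x. u x - \<phi> x) \<in> jet_space I1"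
      using u test_function_H1[OF t(1)] by (rule jet.diff_mem)
    have "jet_norm I1 (\<lambda>x. c * (u x - \<phi> x)) = cmod c * jet_norm I1 (\<lambda>x. u x - \<phi> x)"
      using d by (rule jet.nrm_scale)
    also have "\<dots> \<le> (cmod c + 1) * jet_norm I1 (\<lambda>x. u x - \<phi> x)"
      using jet.nrm_nonneg[OF d] by (simp add: algebra_simps)
    also have "\<dots> < \<epsilon>"
      using t(2) by (simp add: pos_less_divide_eq add_nonneg_pos mult.commute)
    finally have "jet_norm I1 (\<lambda>x. c * u x - (c * \<phi> x + 0 * \<phi> x)) < \<epsilon>"
      by (simp add: right_diff_distrib)
    then show ?thesis by (rule bexI[OF _ test_functions_lincomb[OF t(1,1), of c 0]])
  qed
  then show ?thesis using jet.scale_mem[OF u] by (simp add: H10_def H1_eq H1_norm_eq)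
qed

lemma X_space_eq: "X_space D = jet_space I2 \<inter> H10 D"
  by (simp add: X_space_def H2_eq)

lemma semi_inner_X: "semi_inner (X_space D) (H2_inner D)"
  unfolding H2_inner_eq
  by unfold_locales
    (auto simp: X_space_eq H10_add H10_scale jet.add_mem jet.scale_mem jet.ip_add jet.ip_scale jet.ip_nonneg
      intro: jet.ip_cnj)

sublocale X: semi_inner "X_space D" "H2_inner D"
  rewrites "semi_inner.nrm (H2_inner D) = H2_norm D"
  by (rule semi_inner_X) (simp add: fun_eq_iff H2_norm_def semi_inner.nrm_def[OF semi_inner_X])

text \<open>The second order space is complete, and the zero boundary condition survives the limit:
  the first order norm is the smaller one, so a test function close to a late \<open>f n\<close> is
  also close to \<open>w\<close>.\<close>

theorem X_space_complete:
  assumes f: "\<And>n. f n \<in> X_space D"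
    and cauchy: "\<And>m n. n \<le> m \<Longrightarrow> H2_norm D (\<lambda>x. f m x - f n x) \<le> (1/2) ^ n"
  shows "\<exists>w\<in>X_space D. (\<lambda>n. H2_norm D (\<lambda>x. f n x - w x)) \<longlonglongrightarrow> 0"
proof -
  have "\<exists>w\<in>jet_space I2. (\<lambda>n. jet_norm I2 (\<lambda>x. f n x - w x)) \<longlonglongrightarrow> 0"
    by (rule jet_space_complete[OF finite_I2 _ suffix_I2])
      (use f cauchy in \<open>auto simp: X_space_eq H2_norm_eq I1_def I2_def\<close>)
  then obtain w where w: "w \<in> jet_space I2" "(\<lambda>n. jet_norm I2 (\<lambda>x. f n x - w x)) \<longlonglongrightarrow> 0" by blast
  have w1: "w \<in> jet_space I1" using w(1) I1_subset_I2 by (auto simp: jet_space_def)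
  have "\<exists>\<phi>\<in>test_functions D. jet_norm I1 (\<lambda>x. w x - \<phi> x) < \<epsilon>" if "\<epsilon> > 0" for \<epsilon>
  proof -
    have "\<epsilon>/2 > 0" using that by simp
    then obtain n where n: "jet_norm I2 (\<lambda>x. f n x - w x) < \<epsilon>/2"
      using order_tendstoD(2)[OF w(2)] unfolding eventually_sequentially by blast
    from \<open>\<epsilon>/2 > 0\<close> obtain \<phi> where \<phi>: "\<phi> \<in> test_functions D" "jet_norm I1 (\<lambda>x. f n x - \<phi> x) < \<epsilon>/2"
      using f[of n] unfolding X_space_eq H10_def H1_norm_eq by blast
    have f1: "f n \<in> jet_space I1" using f[of n] by (simp add: X_space_eq H10_def H1_eq)
    have d: "(\<lambda>x. f n x - w x) \<in> jet_space I1" using f1 w1 by (rule jet.diff_mem)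
    have e: "(\<lambda>x. f n x - \<phi> x) \<in> jet_space I1" using f1 test_function_H1[OF \<phi>(1)] by (rule jet.diff_mem)
    have "jet_norm I1 (\<lambda>x. (-1) * (f n x - w x) + (f n x - \<phi> x)) \<le>
        jet_norm I1 (\<lambda>x. (-1) * (f n x - w x)) + jet_norm I1 (\<lambda>x. f n x - \<phi> x)"
      by (rule jet.nrm_triangle[OF jet.scale_mem[OF d] e])
    also have "jet_norm I1 (\<lambda>x. (-1) * (f n x - w x)) = jet_norm I1 (\<lambda>x. f n x - w x)"
      using jet.nrm_scale[OF d, of "-1"] by simp
    also have "\<dots> \<le> jet_norm I2 (\<lambda>x. f n x - w x)"
      by (rule jet_norm_mono[OF I1_subset_I2 finite_I2])
    also have "(\<lambda>x. (-1) * (f n x - w x) + (f n x - \<phi> x)) = (\<lambda>x. w x - \<phi> x)" by simp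
    finally have "jet_norm I1 (\<lambda>x. w x - \<phi> x) < \<epsilon>" using n \<phi>(2) by simp
    then show ?thesis using \<phi>(1) by blast
  qed
  then have "w \<in> X_space D" using w(1) w1 by (simp add: X_space_eq H10_def H1_eq H1_norm_eq)
  then show ?thesis using w(2) by (auto simp: H2_norm_eq)
qed

section \<open>Functions and their Laplacians bounded by the norm of \<open>X_space\<close>\<close>

lemma L2_sum:
  assumes "finite J" "\<And>i. i \<in> J \<Longrightarrow> f i \<in> L2 M"
  shows "(\<lambda>x. \<Sum>i\<in>J. f i x) \<in> L2 M \<and> L2_norm M (\<lambda>x. \<Sum>i\<in>J. f i x) \<le> (\<Sum>i\<in>J. L2_norm M (f i))"
  using assms
proof (induction rule: finite_induct)
  case empty
  then show ?case using L2_const[of 0] by (simp add: L2_norm_def)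
next
  case (insert j J)
  have j: "f j \<in> L2 M" and J: "(\<lambda>x. \<Sum>i\<in>J. f i x) \<in> L2 M" using insert by auto
  show ?case
    using insert L2_add[OF j J] L2.nrm_triangle[OF j J] by auto
qed

lemma weak_laplacian_jet: "weak_laplacian D u = (\<lambda>x. \<Sum>i\<in>Basis. weak_jet [i, i] u x)"
  by (simp add: weak_laplacian_def fun_eq_iff)

text \<open>Each pure second derivative is one of the jets in \<open>I2\<close>, hence bounded by
  the full norm; the factor counts the coordinates.\<close>

lemma weak_laplacian_L2:
  assumes "u \<in> X_space D"
  shows "weak_laplacian D u \<in> L2 M" "L2_norm M (weak_laplacian D u) \<le> DIM('a) * H2_norm D u"
proof -
  have I: "[i, i] \<in> I2" if "i \<in> Basis" for i using that by (auto simp: I2_def)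
  have L: "weak_jet [i, i] u \<in> L2 M" if "i \<in> Basis" for i
    using assms I[OF that] by (intro jet_space_L2[of u I2]) (auto simp: X_space_eq)
  have *: "weak_laplacian D u \<in> L2 M \<and> L2_norm M (weak_laplacian D u) \<le> (\<Sum>i\<in>Basis. L2_norm M (weak_jet [i, i] u))"
    unfolding weak_laplacian_jet by (rule L2_sum) (use L in auto)
  have "(\<Sum>i\<in>Basis. L2_norm M (weak_jet [i, i] u)) \<le> (\<Sum>i\<in>(Basis::'a set). H2_norm D u)"
    unfolding H2_norm_eq by (intro sum_mono L2_norm_weak_jet_le I finite_I2)
  then show "weak_laplacian D u \<in> L2 M" "L2_norm M (weak_laplacian D u) \<le> DIM('a) * H2_norm D u"
    using * by auto
qed

lemma X_space_L2:
  assumes "u \<in> X_space D"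
  shows "u \<in> L2 M" "L2_norm M u \<le> H2_norm D u"
proof -
  have I: "[] \<in> I2" by (simp add: I1_def I2_def)
  show "u \<in> L2 M" using assms jet_space_L2[OF _ I, of u] by (simp add: X_space_eq)
  show "L2_norm M u \<le> H2_norm D u"
    using L2_norm_weak_jet_le[OF I finite_I2, of u] by (simp add: H2_norm_eq)
qed

lemma weak_laplacian_lincomb:
  assumes "u \<in> X_space D" "v \<in> X_space D"
  shows "AE x in M. weak_laplacian D (\<lambda>x. a * u x + b * v x) x = a * weak_laplacian D u x + b * weak_laplacian D v x"
proof -
  have "AE x in M. weak_jet [i, i] (\<lambda>x. a * u x + b * v x) x = a * weak_jet [i, i] u x + b * weak_jet [i, i] v x"
    if "i \<in> Basis" for i
  proof -
    have "[i, i] \<in> I2" using that by (auto simp: I2_def)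
    then have "weak_diff [i, i] u" "weak_diff [i, i] v"
      using assms unfolding X_space_eq jet_space_def by blast+
    then show ?thesis using weak_jet_lincomb by blast
  qed
  then have "AE x in M. \<forall>i\<in>Basis. weak_jet [i, i] (\<lambda>x. a * u x + b * v x) x = a * weak_jet [i, i] u x + b * weak_jet [i, i] v x"
    by (subst AE_ball_countable) (auto intro: countable_finite)
  then show ?thesis
    by eventually_elim (simp add: weak_laplacian_jet sum_distrib_left sum.distrib del: weak_jet.simps)
qed

text \<open>The difference of two solution operators only sees the difference of the two forms, so the
  Riesz representative of the latter turns a solution for one form into a solution for the other.
  If neither problem is solvable, both \<open>SOME\<close> terms choose from the empty predicate and
  coincide.\<close>

lemma B_op_diff_bound:
  assumes u: "u \<in> X_space D"
    and F: "\<And>\<phi>. \<phi> \<in> X_space D \<Longrightarrow> B_form D \<eta> n1 n2 k u \<phi> - B_form D \<eta> n1 n2' k u \<phi> = F \<phi>"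
    and F_add: "\<And>u v. u \<in> X_space D \<Longrightarrow> v \<in> X_space D \<Longrightarrow> F (\<lambda>x. u x + v x) = F u + F v"
    and F_scale: "\<And>c u. u \<in> X_space D \<Longrightarrow> F (\<lambda>x. c * u x) = cnj c * F u"
    and F_bound: "\<And>u. u \<in> X_space D \<Longrightarrow> cmod (F u) \<le> C * H2_norm D u" and C: "0 \<le> C"
  shows "H2_norm D (\<lambda>x. B_op D \<eta> n1 n2 k u x - B_op D \<eta> n1 n2' k u x) \<le> C"
proof -
  define P where "P m w \<longleftrightarrow> w \<in> X_space D \<and> (\<forall>\<phi>\<in>X_space D. H2_inner D w \<phi> = B_form D \<eta> n1 m k u \<phi>)" for m w
  have B_op: "B_op D \<eta> n1 m k u = (SOME w. P m w)" for m
    by (simp add: B_op_def P_def)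
  obtain z where z: "z \<in> X_space D" "\<And>\<phi>. \<phi> \<in> X_space D \<Longrightarrow> H2_inner D z \<phi> = F \<phi>"
  proof -
    have "\<exists>w\<in>X_space D. \<forall>\<phi>\<in>X_space D. H2_inner D w \<phi> = F \<phi>"
    proof (rule X.Riesz_representation)
      show "X_space D \<noteq> {}" using u by blast
    qed (fact F_add F_scale F_bound X_space_complete)+
    then show ?thesis using that by blast
  qed
  have up: "P n2 (\<lambda>x. w x + z x)" if "P n2' w" for w
  proof -
    have w: "w \<in> X_space D" using that by (simp add: P_def)
    have "H2_inner D (\<lambda>x. w x + z x) \<phi> = B_form D \<eta> n1 n2 k u \<phi>" if \<phi>: "\<phi> \<in> X_space D" for \<phi>
      using X.ip_add[OF w z(1) \<phi>] F[OF \<phi>] z(2)[OF \<phi>] \<open>P n2' w\<close> \<phi> by (simp add: P_def algebra_simps)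
    then show ?thesis using X.add_mem[OF w z(1)] by (simp add: P_def)
  qed
  have down: "P n2' (\<lambda>x. w x - z x)" if "P n2 w" for w
  proof -
    have w: "w \<in> X_space D" using that by (simp add: P_def)
    have "H2_inner D (\<lambda>x. w x - z x) \<phi> = B_form D \<eta> n1 n2' k u \<phi>" if \<phi>: "\<phi> \<in> X_space D" for \<phi>
      using X.ip_diff[OF w z(1) \<phi>] F[OF \<phi>] z(2)[OF \<phi>] \<open>P n2 w\<close> \<phi> by (simp add: P_def algebra_simps)
    then show ?thesis using X.diff_mem[OF w z(1)] by (simp add: P_def)
  qed
  show ?thesis
  proof (cases "\<exists>w. P n2 w")
    case True
    then have P: "P n2 (B_op D \<eta> n1 n2 k u)" "P n2' (B_op D \<eta> n1 n2' k u)"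
      unfolding B_op using down by (metis someI)+
    define d where "d = (\<lambda>x. B_op D \<eta> n1 n2 k u x - B_op D \<eta> n1 n2' k u x)"
    have d: "d \<in> X_space D" unfolding d_def using P by (intro X.diff_mem) (auto simp: P_def)
    \<comment> \<open>Testing the difference with itself yields norm^2 <= C norm, and one factor
      cancels; if the norm is zero the claim is \<open>0 <= C\<close>.\<close>
    have "H2_inner D d d = F d"
      using X.ip_diff[of "B_op D \<eta> n1 n2 k u" "B_op D \<eta> n1 n2' k u" d] P d F[OF d]
      unfolding d_def[symmetric] by (simp add: P_def)
    then have "(H2_norm D d)\<^sup>2 \<le> cmod (F d)"
      using X.nrm_sq[OF d] complex_Re_le_cmod by simp
    also have "\<dots> \<le> C * H2_norm D d" by (rule F_bound[OF d])
    finally have "H2_norm D d * H2_norm D d \<le> C * H2_norm D d" by (simp add: power2_eq_square)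
    then show ?thesis
      using X.nrm_nonneg[OF d] C mult_le_cancel_right[of "H2_norm D d" "H2_norm D d" C]
      unfolding d_def by linarith
  next
    case False
    with up have "P n2 = (\<lambda>_. False)" "P n2' = (\<lambda>_. False)" by auto
    \<comment> \<open>The zero function is written as a multiple of \<open>u\<close> so that
      homogeneity gives its norm.\<close>
    then have "(\<lambda>x. B_op D \<eta> n1 n2 k u x - B_op D \<eta> n1 n2' k u x) = (\<lambda>x. 0 * u x)"
      by (simp add: B_op)
    then show ?thesis using X.nrm_scale[OF u, of 0] C by simp
  qed
qed

end

section \<open>Dependence of the operator on the absorption\<close>

context bounded_domain
begin

text \<open>The part of the form that is linear in the coefficient \<open>q\<close>, which stands
  for 1 / (k (n1 - 1) + i n2) or a difference of two such functions. The cube is the factor k^2 of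
  the zeroth order term times the \<open>k\<close> in 1 + k q.\<close>

definition form_diff :: "complex \<Rightarrow> ('a \<Rightarrow> complex) \<Rightarrow> ('a \<Rightarrow> complex) \<Rightarrow> ('a \<Rightarrow> complex) \<Rightarrow> complex" where
  "form_diff k q u \<phi> = k ^ 3 * L2_inner M (\<lambda>x. q x * u x) \<phi>
     + k * L2_inner M (\<lambda>x. q x * weak_laplacian D u x) \<phi>
     + k * L2_inner M (\<lambda>x. q x * u x) (weak_laplacian D \<phi>)"

lemma form_diff_lincomb:
  assumes q: "q \<in> borel_measurable M" "AE x in M. norm (q x) \<le> K"
    and X: "u \<in> X_space D" "\<phi> \<in> X_space D" "\<psi> \<in> X_space D"
  shows "form_diff k q u (\<lambda>x. a * \<phi> x + b * \<psi> x) = cnj a * form_diff k q u \<phi> + cnj b * form_diff k q u \<psi>"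
proof -
  note qL = L2_bounded_mult[OF _ q]
  have lin: "L2_inner M w (\<lambda>x. a * f x + b * g x) = cnj a * L2_inner M w f + cnj b * L2_inner M w g"
    if "w \<in> L2 M" "f \<in> L2 M" "g \<in> L2 M" for w f g
    using that L2_scale[OF that(2), of a] L2_scale[OF that(3), of b] by (simp add: L2.ip_add2 L2.ip_scale2)
  note W = qL[OF X_space_L2(1)[OF X(1)]] qL[OF weak_laplacian_L2(1)[OF X(1)]]
  note L = X_space_L2(1)[OF X(2)] X_space_L2(1)[OF X(3)]
    weak_laplacian_L2(1)[OF X(2)] weak_laplacian_L2(1)[OF X(3)]
  have c: "(\<lambda>x. a * \<phi> x + b * \<psi> x) \<in> X_space D"
    by (intro X.add_mem X.scale_mem X)
  have meas: "(\<lambda>x. a * weak_laplacian D \<phi> x + b * weak_laplacian D \<psi> x) \<in> borel_measurable M"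
    using L2_add[OF L2_scale[OF L(3)] L2_scale[OF L(4)]] by (simp add: L2_def)
  have "L2_inner M (\<lambda>x. q x * u x) (weak_laplacian D (\<lambda>x. a * \<phi> x + b * \<psi> x)) =
      L2_inner M (\<lambda>x. q x * u x) (\<lambda>x. a * weak_laplacian D \<phi> x + b * weak_laplacian D \<psi> x)"
    by (rule L2_inner_cong_AE[OF W(1) weak_laplacian_L2(1)[OF c] _ meas _ weak_laplacian_lincomb[OF X(2,3)]])
      (use W(1) in \<open>simp_all add: L2_def\<close>)
  then show ?thesis
    using L by (simp add: form_diff_def lin W algebra_simps)
qed

text \<open>Cauchy-Schwarz on each summand. The zeroth order term contributes the cube, and each of
  the two Laplacian terms contributes \<open>cmod k\<close> times the dimension.\<close>

lemma form_diff_bound: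
  assumes q: "q \<in> borel_measurable M" "AE x in M. norm (q x) \<le> K" "0 \<le> K"
    and X: "u \<in> X_space D" "\<phi> \<in> X_space D"
  shows "cmod (form_diff k q u \<phi>) \<le> (cmod k ^ 3 + 2 * cmod k * DIM('a)) * K * H2_norm D u * H2_norm D \<phi>"
proof -
  let ?n = "H2_norm D u" and ?m = "H2_norm D \<phi>" and ?d = "real DIM('a)"
  have le: "cmod (L2_inner M (\<lambda>x. q x * f x) g) \<le> K * A * B"
    if f: "f \<in> L2 M" "g \<in> L2 M" "L2_norm M f \<le> A" "L2_norm M g \<le> B" for f g A B
  proof -
    have "cmod (L2_inner M (\<lambda>x. q x * f x) g) \<le> L2_norm M (\<lambda>x. q x * f x) * L2_norm M g"
      by (rule L2.Cauchy_Schwarz[OF L2_bounded_mult[OF f(1) q(1,2)] f(2)])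
    also have "\<dots> \<le> (K * L2_norm M f) * L2_norm M g"
      by (intro mult_right_mono L2_norm_bounded_mult f q L2.nrm_nonneg)
    also have "\<dots> \<le> (K * A) * B"
    proof -
      have "0 \<le> A" using f(3) L2.nrm_nonneg[OF f(1)] by linarith
      then show ?thesis
        using f q(3) L2.nrm_nonneg[OF f(1)] L2.nrm_nonneg[OF f(2)] by (intro mult_mono) auto
    qed
    finally show ?thesis .
  qed
  note L = X_space_L2[OF X(1)] X_space_L2[OF X(2)] weak_laplacian_L2[OF X(1)] weak_laplacian_L2[OF X(2)]
  have "cmod (form_diff k q u \<phi>) \<le> cmod k ^ 3 * cmod (L2_inner M (\<lambda>x. q x * u x) \<phi>)
      + cmod k * cmod (L2_inner M (\<lambda>x. q x * weak_laplacian D u x) \<phi>)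
      + cmod k * cmod (L2_inner M (\<lambda>x. q x * u x) (weak_laplacian D \<phi>))"
    unfolding form_diff_def norm_power[symmetric] norm_mult[symmetric]
    by (intro order_trans[OF norm_triangle_ineq] add_mono order_refl)
  also have "\<dots> \<le> cmod k ^ 3 * (K * ?n * ?m) + cmod k * (K * (?d * ?n) * ?m) + cmod k * (K * ?n * (?d * ?m))"
    using L by (intro add_mono mult_left_mono le) auto
  also have "\<dots> = (cmod k ^ 3 + 2 * cmod k * ?d) * K * ?n * ?m"
    by (simp add: algebra_simps)
  finally show ?thesis .
qed

text \<open>Only the last summand contains \<open>n2\<close>; the others cancel when two absorptions
  are compared. The boundary integral is carried along unevaluated.\<close>

lemma B_form_resolvent:
  fixes n1 n2 :: "'a \<Rightarrow> real" and k :: complex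
  defines "r \<equiv> \<lambda>x. 1 / (k * complex_of_real (n1 x - 1) + \<i> * complex_of_real (n2 x))"
  assumes [measurable]: "n1 \<in> borel_measurable M" "n2 \<in> borel_measurable M"
    and nz: "AE x in M. k * complex_of_real (n1 x - 1) + \<i> * complex_of_real (n2 x) \<noteq> 0"
    and r: "AE x in M. norm (r x) \<le> K"
    and X: "u \<in> X_space D" "\<phi> \<in> X_space D"
  shows "B_form D \<eta> n1 n2 k u \<phi> =
      (LINT x|surface_measure D.
        complex_of_real (1 / \<eta> x) * normal_deriv D u x * cnj (normal_deriv D \<phi> x))
     - (LINT x|M. (\<Sum>i\<in>Basis. weak_partial D i u x * cnj (weak_partial D i \<phi> x)))
     + k\<^sup>2 * L2_inner M u \<phi> + form_diff k r u \<phi>"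
proof -
  have [measurable]: "r \<in> borel_measurable M" unfolding r_def by measurable
  note qL = L2_bounded_mult[OF _ \<open>r \<in> borel_measurable M\<close> r]
  note W = qL[OF X_space_L2(1)[OF X(1)]] qL[OF weak_laplacian_L2(1)[OF X(1)]]
  note L = X_space_L2(1)[OF X(1)] X_space_L2(1)[OF X(2)]
    weak_laplacian_L2(1)[OF X(1)] weak_laplacian_L2(1)[OF X(2)]
  have [measurable]: "u \<in> borel_measurable M" "\<phi> \<in> borel_measurable M"
    using L by (auto simp: L2_def)
  have "(LINT x|M. (k * complex_of_real (n1 x) + \<i> * complex_of_real (n2 x))
          / (k * complex_of_real (n1 x - 1) + \<i> * complex_of_real (n2 x)) * u x * cnj (\<phi> x)) =
        (LINT x|M. u x * cnj (\<phi> x) + k * (r x * u x * cnj (\<phi> x)))"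
  proof (rule integral_cong_AE)
    show "AE x in M. (k * complex_of_real (n1 x) + \<i> * complex_of_real (n2 x))
          / (k * complex_of_real (n1 x - 1) + \<i> * complex_of_real (n2 x)) * u x * cnj (\<phi> x) =
        u x * cnj (\<phi> x) + k * (r x * u x * cnj (\<phi> x))"
      using nz
    proof eventually_elim
      case (elim x)
      \<comment> \<open>The numerator is the denominator plus \<open>k\<close>.\<close>
      define d where "d = k * complex_of_real (n1 x - 1) + \<i> * complex_of_real (n2 x)"
      have "k * complex_of_real (n1 x) + \<i> * complex_of_real (n2 x) = d + k"
        by (simp add: d_def algebra_simps)
      moreover have "(d + k) / d = 1 + k * r x"
        using elim unfolding r_def d_def[symmetric] by (simp add: add_divide_distrib)
      ultimately show ?case unfolding d_def[symmetric] by (simp add: algebra_simps)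
    qed
  qed measurable
  also have "\<dots> = L2_inner M u \<phi> + k * L2_inner M (\<lambda>x. r x * u x) \<phi>"
    unfolding L2_inner_def
    using L2_mult_cnj_integrable[OF L(1,2)] L2_mult_cnj_integrable[OF W(1) L(2)] by simp
  finally have t1: "(LINT x|M. (k * complex_of_real (n1 x) + \<i> * complex_of_real (n2 x))
          / (k * complex_of_real (n1 x - 1) + \<i> * complex_of_real (n2 x)) * u x * cnj (\<phi> x)) =
        L2_inner M u \<phi> + k * L2_inner M (\<lambda>x. r x * u x) \<phi>" .
  have "(LINT x|M. r x * (cnj (\<phi> x) * weak_laplacian D u x + u x * cnj (weak_laplacian D \<phi> x))) =
      (LINT x|M. (r x * weak_laplacian D u x) * cnj (\<phi> x) + (r x * u x) * cnj (weak_laplacian D \<phi> x))"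
    by (intro Bochner_Integration.integral_cong) (auto simp: algebra_simps)
  also have "\<dots> = L2_inner M (\<lambda>x. r x * weak_laplacian D u x) \<phi> + L2_inner M (\<lambda>x. r x * u x) (weak_laplacian D \<phi>)"
    unfolding L2_inner_def
    using L2_mult_cnj_integrable[OF W(2) L(2)] L2_mult_cnj_integrable[OF W(1) L(4)]
    by (rule Bochner_Integration.integral_add)
  finally show ?thesis
    unfolding B_form_def t1 form_diff_def r_def[symmetric]
    by (simp add: r_def algebra_simps power2_eq_square power3_eq_cube)
qed

lemma form_diff_minus:
  assumes r: "r \<in> borel_measurable M" "AE x in M. norm (r x) \<le> K"
    and r': "r' \<in> borel_measurable M" "AE x in M. norm (r' x) \<le> K'"
    and X: "u \<in> X_space D" "\<phi> \<in> X_space D"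
  shows "form_diff k r u \<phi> - form_diff k r' u \<phi> = form_diff k (\<lambda>x. r x - r' x) u \<phi>"
proof -
  note L = X_space_L2(1)[OF X(1)] X_space_L2(1)[OF X(2)]
    weak_laplacian_L2(1)[OF X(1)] weak_laplacian_L2(1)[OF X(2)]
  have minus: "L2_inner M (\<lambda>x. (r x - r' x) * f x) g = L2_inner M (\<lambda>x. r x * f x) g - L2_inner M (\<lambda>x. r' x * f x) g"
    if "f \<in> L2 M" "g \<in> L2 M" for f g
    using L2.ip_diff[OF L2_bounded_mult[OF that(1) r] L2_bounded_mult[OF that(1) r'] that(2)]
    by (simp add: left_diff_distrib)
  show ?thesis
    unfolding form_diff_def minus[OF L(1,2)] minus[OF L(3,2)] minus[OF L(1,4)]
    by (simp add: right_diff_distrib)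
qed

text \<open>The reciprocals differ by (d0 - d) / (d d0), with numerator at most
  \<open>\<delta>\<close>, |d0| >= e and |d| >= e / 2 for e = |k| c. So the coefficient
  \<open>q\<close> is bounded by 2 \<delta> / e^2, and the bound on \<open>form_diff\<close> does
  the rest.\<close>

lemma H2_norm_B_op_diff_le:
  assumes n1: "n1 \<in> borel_measurable M" and n2: "n2 \<in> borel_measurable M"
    and c: "0 < c" "AE x in M. c \<le> \<bar>n1 x - 1\<bar>"
    and \<delta>: "0 \<le> \<delta>" "\<delta> \<le> cmod k * c / 2" "AE x in M. \<bar>n2 x\<bar> \<le> \<delta>"
    and k: "k \<noteq> 0"
    and u: "u \<in> X_space D" "H2_norm D u \<le> 1"
  shows "H2_norm D (\<lambda>x. B_op D \<eta> n1 n2 k u x - B_op D \<eta> n1 (\<lambda>_. 0) k u x)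
    \<le> (cmod k ^ 3 + 2 * cmod k * DIM('a)) * (2 / (cmod k * c)\<^sup>2) * \<delta>"
proof -
  define den where "den m x = k * complex_of_real (n1 x - 1) + \<i> * complex_of_real (m x)" for m x
  define z where "z = (\<lambda>_::'a. 0::real)"
  define e where "e = cmod k * c"
  have e: "0 < e" using k c by (simp add: e_def)
  have den_ge: "AE x in M. e / 2 \<le> norm (den n2 x) \<and> e \<le> norm (den z x) \<and> norm (den z x - den n2 x) \<le> \<delta>"
    using c(2) \<delta>(3)
  proof eventually_elim
    case (elim x)
    have "e \<le> cmod k * \<bar>n1 x - 1\<bar>" using elim(1) by (simp add: e_def mult_left_mono)
    also have "\<dots> = norm (den z x)" by (simp add: den_def z_def norm_mult flip: of_real_diff)
    finally have z: "e \<le> norm (den z x)" .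
    have d: "norm (den z x - den n2 x) \<le> \<delta>"
      using elim(2) by (simp add: den_def z_def norm_mult)
    \<comment> \<open>Perturbation: at least e - \<delta> >= e / 2 remains of the denominator with
      absorption.\<close>
    moreover have "norm (den z x) \<le> norm (den z x - den n2 x) + norm (den n2 x)"
      using norm_triangle_ineq[of "den z x - den n2 x" "den n2 x"] by simp
    ultimately show ?case using z \<delta>(2) by (simp add: e_def)
  qed
  \<comment> \<open>The common bound 2 / e makes both reciprocals L2 multipliers; smallness is
    obtained only for their difference.\<close>
  have nz: "AE x in M. den m x \<noteq> 0" and r: "AE x in M. norm (1 / den m x) \<le> 2 / e"
    if "m \<in> {n2, z}" for m
  proof -
    have ge: "AE x in M. e / 2 \<le> norm (den m x)"
      using den_ge by eventually_elim (use that e in auto)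
    then show "AE x in M. den m x \<noteq> 0" by eventually_elim (use e in auto)
    show "AE x in M. norm (1 / den m x) \<le> 2 / e"
      using ge
    proof eventually_elim
      case (elim x)
      then have "1 / norm (den m x) \<le> 1 / (e / 2)" using e by (intro frac_le) auto
      then show ?case by (simp add: norm_divide)
    qed
  qed
  have mem: "n2 \<in> {n2, z}" "z \<in> {n2, z}" by auto
  note [measurable] = n1 n2
  have zm[measurable]: "z \<in> borel_measurable M" by (simp add: z_def)
  have rm: "(\<lambda>x. 1 / den n2 x) \<in> borel_measurable M" "(\<lambda>x. 1 / den z x) \<in> borel_measurable M"
    unfolding den_def by measurable
  define q where "q x = 1 / den n2 x - 1 / den z x" for x
  define K where "K = 2 / e\<^sup>2 * \<delta>"
  have K: "0 \<le> K" using \<delta>(1) by (simp add: K_def)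
  have q: "q \<in> borel_measurable M" using rm unfolding q_def by measurable
  have qK: "AE x in M. norm (q x) \<le> K"
    using den_ge
  proof eventually_elim
    case (elim x)
    then have nz: "den n2 x \<noteq> 0" "den z x \<noteq> 0" using e by auto
    then have "q x = (den z x - den n2 x) / (den n2 x * den z x)"
      by (simp add: q_def diff_divide_distrib)
    then have "norm (q x) = norm (den z x - den n2 x) / (norm (den n2 x) * norm (den z x))"
      by (simp add: norm_divide norm_mult)
    also have "\<dots> \<le> \<delta> / ((e / 2) * e)"
      using elim e \<delta>(1) by (intro frac_le mult_mono) auto
    also have "\<dots> = K" by (simp add: K_def power2_eq_square)
    finally show ?case .
  qed
  let ?C = "(cmod k ^ 3 + 2 * cmod k * DIM('a)) * K"
  have "H2_norm D (\<lambda>x. B_op D \<eta> n1 n2 k u x - B_op D \<eta> n1 z k u x) \<le> ?C"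
  proof (rule B_op_diff_bound[where F = "form_diff k q u"])
    fix \<phi> assume \<phi>: "\<phi> \<in> X_space D"
    show "B_form D \<eta> n1 n2 k u \<phi> - B_form D \<eta> n1 z k u \<phi> = form_diff k q u \<phi>"
      unfolding B_form_resolvent[OF n1 n2 nz[OF mem(1), unfolded den_def] r[OF mem(1), unfolded den_def] u(1) \<phi>]
        B_form_resolvent[OF n1 zm nz[OF mem(2), unfolded den_def] r[OF mem(2), unfolded den_def] u(1) \<phi>]
      using form_diff_minus[OF rm(1) r[OF mem(1)] rm(2) r[OF mem(2)] u(1) \<phi>, of k]
      unfolding q_def[abs_def] den_def by simp
    have "cmod (form_diff k q u \<phi>) \<le> ?C * H2_norm D u * H2_norm D \<phi>"
      by (rule form_diff_bound[OF q qK K u(1) \<phi>])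
    also have "\<dots> \<le> ?C * 1 * H2_norm D \<phi>"
      using u(2) K X.nrm_nonneg[OF \<phi>] by (intro mult_right_mono mult_left_mono) auto
    finally show "cmod (form_diff k q u \<phi>) \<le> ?C * H2_norm D \<phi>" by simp
    show "form_diff k q u (\<lambda>x. a * \<phi> x) = cnj a * form_diff k q u \<phi>" for a
      using form_diff_lincomb[OF q qK u(1) \<phi> \<phi>, of k a 0] by simp
    show "form_diff k q u (\<lambda>x. \<phi> x + \<psi> x) = form_diff k q u \<phi> + form_diff k q u \<psi>"
      if "\<psi> \<in> X_space D" for \<psi>
      using form_diff_lincomb[OF q qK u(1) \<phi> that, of k 1 1] by simp
  qed (use u K in auto)
  then show ?thesis unfolding z_def K_def e_def by (simp only: mult.assoc)
qed

end

section \<open>Convergence along the filter of vanishing absorptions\<close>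

theorem theorem3p6:
  fixes D :: "'a::euclidean_space set"
    and n1 \<eta> :: "'a \<Rightarrow> real"
    and k :: complex
  assumes "DIM('a) \<in> {2, 3}"
    and "open D" and "bounded D" and "simply_connected D" and "C2_boundary D"
    and "n1 \<in> Linf (lebesgue_on D)" and "AE x in lebesgue_on D. 0 < n1 x"
    and "\<eta> \<in> Linf (surface_measure D)" and "AE x in surface_measure D. 0 < \<eta> x"
    and "(\<lambda>x. 1 / \<eta> x) \<in> Linf (surface_measure D)"
    and "\<exists>c>0. (AE x in lebesgue_on D. n1 x - 1 \<ge> c) \<or> (AE x in lebesgue_on D. n1 x - 1 \<le> - c)"
    and "Re k > 0"
  shows "((\<lambda>n2. op_norm D (\<lambda>u x. B_op D \<eta> n1 n2 k u x - B_op D \<eta> n1 (\<lambda>_. 0) k u x)) \<longlongrightarrow> 0)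
           (absorption_to_zero D)"
proof -
  interpret bounded_domain D using assms by unfold_locales
  let ?M = "lebesgue_on D"
  let ?T = "\<lambda>n2. op_norm D (\<lambda>u x. B_op D \<eta> n1 n2 k u x - B_op D \<eta> n1 (\<lambda>_. 0) k u x)"
  let ?A = "absorption_to_zero D"
  obtain c where c: "c > 0" "AE x in ?M. c \<le> \<bar>n1 x - 1\<bar>"
  proof -
    obtain c where c: "c > 0" "(AE x in ?M. n1 x - 1 \<ge> c) \<or> (AE x in ?M. n1 x - 1 \<le> - c)"
      using assms(11) by blast
    from c(2) have "AE x in ?M. c \<le> \<bar>n1 x - 1\<bar>"
    proof
      assume "AE x in ?M. n1 x - 1 \<ge> c"
      then show ?thesis by eventually_elim linarith
    next
      assume "AE x in ?M. n1 x - 1 \<le> - c"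
      then show ?thesis by eventually_elim linarith
    qed
    with c(1) show ?thesis using that by blast
  qed
  have k: "k \<noteq> 0" using assms(12) by auto
  have n1: "n1 \<in> borel_measurable ?M" using assms(6) by (simp add: Linf_def)
  define C where "C = (cmod k ^ 3 + 2 * cmod k * DIM('a)) * (2 / (cmod k * c)\<^sup>2)"
  have C: "0 \<le> C" by (simp add: C_def)
  \<comment> \<open>The filter refines the pullback of the neighbourhoods of 0 under the supremum
    norm.\<close>
  have lim: "(Linf_norm ?M \<longlongrightarrow> 0) ?A"
    unfolding absorption_to_zero_def
    by (rule filterlim_mono[OF filterlim_filtercomap order_refl inf_le1])
  have ev: "\<forall>\<^sub>F n2 in ?A. n2 \<in> Linf ?M"
    unfolding absorption_to_zero_def eventually_inf_principal by (simp add: eventually_mono)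
  \<comment> \<open>Below this threshold the denominator with absorption stays away from
    zero.\<close>
  have "0 < cmod k * c / 2" using k c by simp
  then have "\<forall>\<^sub>F n2 in ?A. Linf_norm ?M n2 < ennreal (cmod k * c / 2)"
    by (intro order_tendstoD(2)[OF lim]) simp
  then have "\<forall>\<^sub>F n2 in ?A. ?T n2 \<le> ennreal C * Linf_norm ?M n2"
    using ev
  proof eventually_elim
    case (elim n2)
    have n2: "n2 \<in> borel_measurable ?M" using elim(2) by (simp add: Linf_def)
    \<comment> \<open>The norm is finite, being below the threshold, so passing to a real number
      loses nothing.\<close>
    define \<delta> where "\<delta> = enn2real (Linf_norm ?M n2)"
    have \<delta>: "ennreal \<delta> = Linf_norm ?M n2"
      unfolding \<delta>_def by (rule ennreal_enn2real[OF less_trans[OF elim(1) ennreal_less_top]])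
    have "AE x in ?M. ennreal \<bar>n2 x\<bar> \<le> ennreal \<delta>"
      unfolding \<delta> Linf_norm_def by (rule esssup_AE)
    then have ae: "AE x in ?M. \<bar>n2 x\<bar> \<le> \<delta>"
      by eventually_elim (simp add: \<delta>_def)
    have "ennreal \<delta> < ennreal (cmod k * c / 2)" using elim(1) by (simp only: \<delta>)
    then have le: "\<delta> \<le> cmod k * c / 2"
      by (simp add: ennreal_less_iff \<delta>_def)
    have "?T n2 \<le> ennreal (C * \<delta>)"
      unfolding op_norm_def
    proof (rule SUP_least)
      fix u assume "u \<in> {u \<in> X_space D. H2_norm D u \<le> 1}"
      then have u: "u \<in> X_space D" "H2_norm D u \<le> 1" by auto
      have "0 \<le> \<delta>" by (simp add: \<delta>_def)
      from H2_norm_B_op_diff_le[OF n1 n2 c this le ae k u]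
      show "ennreal (H2_norm D (\<lambda>x. B_op D \<eta> n1 n2 k u x - B_op D \<eta> n1 (\<lambda>_. 0) k u x)) \<le> ennreal (C * \<delta>)"
        by (intro ennreal_leI) (simp add: C_def)
    qed
    also have "\<dots> = ennreal C * Linf_norm ?M n2"
      unfolding \<delta>[symmetric] using C by (rule ennreal_mult')
    finally show ?case .
  qed
  moreover have "((\<lambda>n2. ennreal C * Linf_norm ?M n2) \<longlongrightarrow> 0) ?A"
    using ennreal_tendsto_cmult[OF _ lim, of "ennreal C"] by simp
  ultimately show ?thesis
    by (rule tendsto_sandwich[OF always_eventually _ tendsto_const, rotated]) simp
qed

end
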